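(* Let $\Theta$ be a first-order signature. For every set $\Gamma\cup\{\varphi\}\subseteq For(\Theta)$: $\Gamma\vdash_{\mathbf{QmbC}}\varphi$ if and only if $\Gamma\models_{(\mathfrak A,\mathcal M_5)}\varphi$ for every structure $\mathfrak A$ over $\Theta$ and $\mathcal M_5$.
   Context: **Language.** $Var$ is a denumerable set of individual variables. A first-order signature $\Theta$ consists of a set $\mathcal C$ of individual constants and, for each $n\ge 1$, sets $\mathcal F_n$ and $\mathcal P_n$ of function and predicate symbols of arity $n$ (with at least one predicate symbol). Formulas are built with binary connectives $\wedge,\vee,\to$, unary connectives $\neg,\circ$, and quantifiers $\forall,\exists$. $Ter(\Theta)$, $CTer(\Theta)$, $For(\Theta)$, $Sen(\Theta)$ are the sets of terms, closed terms, formulas and sentences. $\varphi[x/t]$ is the result of replacing every free occurrence of $x$ in $\varphi$ by $t$. Two formulas are *variants* if one is obtained from the other by addition or deletion of void quantifiers, or by renaming bound variables (keeping the same free variables in the same places). **Calculus QmbC** (Hilbert calculus over $For(\Theta)$). Axiom schemas: (A1) $\alpha\to(\beta\to\alpha)$; (A2) $(\alpha\to(\beta\to\gamma))\to((\alpha\to\beta)\to(\alpha\to\gamma))$; (A3) $\alpha\to(\beta\to(\alpha\wedge\beta))$; (A4) $(\alpha\wedge\beta)\to\alpha$; (A5) $(\alpha\wedge\beta)\to\beta$; (A6) $\alpha\to(\alpha\vee\beta)$; (A7) $\beta\to(\alpha\vee\beta)$; (A8) $(\alpha\to\gamma)\to((\beta\to\gamma)\to((\alpha\vee\beta)\to\gamma))$;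 (A9) $\alpha\vee(\alpha\to\beta)$; (A10) $\alpha\vee\neg\alpha$; (A11) $\circ\alpha\to(\alpha\to(\neg\alpha\to\beta))$; (Ax12) $\varphi[x/t]\to\exists x\varphi$ if $t$ is free for $x$ in $\varphi$; (Ax13) $\forall x\varphi\to\varphi[x/t]$ if $t$ is free for $x$ in $\varphi$; (Ax14) $\alpha\to\beta$ whenever $\alpha$ is a variant of $\beta$. Rules: (MP) from $\alpha$, $\alpha\to\beta$ infer $\beta$; ($\exists$-In) from $\varphi\to\psi$ infer $\exists x\varphi\to\psi$ if $x$ is not free in $\psi$; ($\forall$-In) from $\varphi\to\psi$ infer $\varphi\to\forall x\psi$ if $x$ is not free in $\varphi$. $\Gamma\vdash_{\mathbf{QmbC}}\varphi$ means there is a finite derivation of $\varphi$ whose steps are axiom instances, members of $\Gamma$, or follow from earlier steps by a rule. **The Nmatrix $\mathcal M_5$.** Let $\mathcal A_2$ be the two-element Boolean algebra with domain $\{0,1\}$ and let $B_{\mathcal A_2}=\{x\in\{0,1\}^3: x_1\vee x_2=1,\ x_1\wedge x_2\wedge x_3=0\}=\{(1,0,1),(1,1,0),(1,0,0),(0,1,1),(0,1,0)\}$, where $x_i$ is the $i$-th coordinate. $\mathcal M_5$ is the multialgebra with domain $|\mathcal M_5|=B_{\mathcal A_2}$ and multioperations $x\tilde\# y=\{z\in B_{\mathcal A_2}: z_1=x_1\# y_1\}$ for $\#\in\{\wedge,\vee,\to\}$ (Boolean operations on the right), $\tilde\neg x=\{z: z_1=x_2\}$, $\tilde\circ x=\{z: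 z_1=x_3\}$, together with the set of designated values $\mathrm D=\{x\in B_{\mathcal A_2}: x_1=1\}$. **Structures and valuations.** A structure $\mathfrak A=\langle U,I_{\mathfrak A}\rangle$ over $\mathcal M_5$ and $\Theta$ has a nonempty domain $U$ and assigns $c^{\mathfrak A}\in U$ to constants, $f^{\mathfrak A}:U^n\to U$ to $n$-ary function symbols, and $P^{\mathfrak A}:U^n\to|\mathcal M_5|$ to $n$-ary predicate symbols. $\Theta_U$ is $\Theta$ plus a new constant $\bar a$ for each $a\in U$; $\widehat{\mathfrak A}$ extends $\mathfrak A$ by interpreting $\bar a$ as $a$. An assignment is a map $\mu:Var\to U$; $[\![t]\!]^{\widehat{\mathfrak A}}_\mu\in U$ is the usual value of a term $t$ (the subscript is omitted for closed terms); $\widehat\mu(s)$ is obtained from a term or formula $s$ over $\Theta_U$ by replacing each free variable $x$ by $\overline{\mu(x)}$; $\mu^x_a$ is $\mu$ changed to take value $a$ at $x$. A *QmbC-valuation* over $\mathfrak A$ and $\mathcal M_5$ is a map $v:Sen(\Theta_U)\to|\mathcal M_5|$ such that: (i) $v(P(t_1,\dots,t_n))=P^{\mathfrak A}([\![t_1]\!]^{\widehat{\mathfrak A}},\dots,[\![t_n]\!]^{\widehat{\mathfrak A}})$; (ii) $v(\#\varphi)\in\tilde\# v(\varphi)$ for $\#\in\{\neg,\circ\}$; (iii) $v(\varphi\#\psi)\in v(\varphi)\tilde\# v(\psi)$ for $\#\in\{\wedge,\vee,\to\}$; (iv) $(v(\forall x\varphi))_1=\bigwedge_{a\in U}(v(\varphi[x/\bar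 a]))_1$; (v) $(v(\exists x\varphi))_1=\bigvee_{a\in U}(v(\varphi[x/\bar a]))_1$; (vi) whenever $t$ is free for $z$ in $\varphi$ and $\psi$, $\mu$ is an assignment and $b=[\![t]\!]^{\widehat{\mathfrak A}}_\mu$: (vi.1) if $v(\widehat\mu(\varphi[z/t]))=v(\widehat\mu(\varphi[z/\bar b]))$ then $v(\widehat\mu((\#\varphi)[z/t]))=v(\widehat\mu((\#\varphi)[z/\bar b]))$ for $\#\in\{\neg,\circ\}$; (vi.2) if $v(\widehat\mu(\varphi[z/t]))=v(\widehat\mu(\varphi[z/\bar b]))$ and $v(\widehat\mu(\psi[z/t]))=v(\widehat\mu(\psi[z/\bar b]))$ then $v(\widehat\mu((\varphi\#\psi)[z/t]))=v(\widehat\mu((\varphi\#\psi)[z/\bar b]))$ for $\#\in\{\wedge,\vee,\to\}$; (vi.3) if $x\ne z$, $x$ does not occur in $t$, and $v(\widehat{\mu^x_a}(\varphi[z/t]))=v(\widehat{\mu^x_a}(\varphi[z/\bar b]))$ for every $a\in U$, then $v(\widehat\mu((Qx\varphi)[z/t]))=v(\widehat\mu((Qx\varphi)[z/\bar b]))$ for $Q\in\{\forall,\exists\}$; (vii) $v(\varphi)=v(\varphi')$ if $\varphi,\varphi'$ are variants. Put $v_\mu(\varphi)=v(\widehat\mu(\varphi))$ for $\varphi\in For(\Theta_U)$. **Consequence.** $\Gamma\models_{(\mathfrak A,\mathcal M_5)}\varphi$ iff for every QmbC-valuation $v$ over $\mathfrak A$ and $\mathcal M_5$: if $v_\mu(\gamma)\in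 \mathrm D$ for all $\gamma\in\Gamma$ and all assignments $\mu$, then $v_\mu(\varphi)\in\mathrm D$ for all $\mu$. *)

theory Defs
  imports "HOL-Library.Equipollence"
begin

section \<open>Language\<close>

text \<open>The individual variables are the natural numbers.  The type parameters
  \<open>'c\<close>, \<open>'f\<close>, \<open>'p\<close> only provide names; which of them are symbols, and of which arity, is
  determined by the signature.  \<open>fn \<Theta> n\<close> and \<open>pr \<Theta> n\<close> are only ever consulted for \<open>n \<ge> 1\<close>.
  In \<open>Fun f ts\<close> and \<open>Pred P ts\<close> the arity is \<open>length ts\<close>, so a name used at several arities
  stands for several distinct symbols.\<close>

record ('c, 'f, 'p) sig =
  cn :: "'c set"
  fn :: "nat \<Rightarrow> 'f set"
  pr :: "nat \<Rightarrow> 'p set"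

definition signature :: "('c, 'f, 'p) sig \<Rightarrow> bool" where
  "signature \<Theta> \<longleftrightarrow> (\<exists>n\<ge>1. pr \<Theta> n \<noteq> {})"

datatype ('c, 'f) trm = Var nat | Cst 'c | Fun 'f "('c, 'f) trm list"

datatype unop = UNeg | UCirc
datatype binop = BAnd | BOr | BImp
datatype quant = QAll | QEx

datatype ('c, 'f, 'p) fm =
    Pred 'p "('c, 'f) trm list"
  | Unary unop "('c, 'f, 'p) fm"
  | Binary binop "('c, 'f, 'p) fm" "('c, 'f, 'p) fm"
  | Quant quant nat "('c, 'f, 'p) fm"

abbreviation Neg where "Neg \<equiv> Unary UNeg"
abbreviation Circ where "Circ \<equiv> Unary UCirc"
abbreviation Conj (infixr \<open>\<^bold>\<and>\<close> 75) where "\<alpha> \<^bold>\<and> \<beta> \<equiv> Binary BAnd \<alpha> \<beta>"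
abbreviation Disj (infixr \<open>\<^bold>\<or>\<close> 70) where "\<alpha> \<^bold>\<or> \<beta> \<equiv> Binary BOr \<alpha> \<beta>"
abbreviation Imp (infixr \<open>\<^bold>\<longrightarrow>\<close> 65) where "\<alpha> \<^bold>\<longrightarrow> \<beta> \<equiv> Binary BImp \<alpha> \<beta>"
abbreviation Forall where "Forall \<equiv> Quant QAll"
abbreviation Exists where "Exists \<equiv> Quant QEx"

inductive_set Ter :: "('c, 'f, 'p) sig \<Rightarrow> ('c, 'f) trm set" for \<Theta> where
  "Var x \<in> Ter \<Theta>"
| "c \<in> cn \<Theta> \<Longrightarrow> Cst c \<in> Ter \<Theta>"
| "\<lbrakk>ts \<noteq> []; f \<in> fn \<Theta> (length ts); \<forall>t\<in>set ts. t \<in> Ter \<Theta>\<rbrakk> \<Longrightarrow> Fun f ts \<in> Ter \<Theta>"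

inductive_set For :: "('c, 'f, 'p) sig \<Rightarrow> ('c, 'f, 'p) fm set" for \<Theta> where
  "\<lbrakk>ts \<noteq> []; P \<in> pr \<Theta> (length ts); \<forall>t\<in>set ts. t \<in> Ter \<Theta>\<rbrakk> \<Longrightarrow> Pred P ts \<in> For \<Theta>"
| "\<phi> \<in> For \<Theta> \<Longrightarrow> Unary h \<phi> \<in> For \<Theta>"
| "\<lbrakk>\<phi> \<in> For \<Theta>; \<psi> \<in> For \<Theta>\<rbrakk> \<Longrightarrow> Binary h \<phi> \<psi> \<in> For \<Theta>"
| "\<phi> \<in> For \<Theta> \<Longrightarrow> Quant Q x \<phi> \<in> For \<Theta>"

fun vars :: "('c, 'f) trm \<Rightarrow> nat set" where
  "vars (Var x) = {x}"
| "vars (Cst c) = {}"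
| "vars (Fun f ts) = (\<Union>t\<in>set ts. vars t)"

fun FV :: "('c, 'f, 'p) fm \<Rightarrow> nat set" where
  "FV (Pred P ts) = (\<Union>t\<in>set ts. vars t)"
| "FV (Unary h \<phi>) = FV \<phi>"
| "FV (Binary h \<phi> \<psi>) = FV \<phi> \<union> FV \<psi>"
| "FV (Quant Q x \<phi>) = FV \<phi> - {x}"

definition Sen :: "('c, 'f, 'p) sig \<Rightarrow> ('c, 'f, 'p) fm set" where
  "Sen \<Theta> = {\<phi> \<in> For \<Theta>. FV \<phi> = {}}"

text \<open>Simultaneous replacement of all free occurrences of variables.  Bound variables are
  never renamed, so capture is possible; it is excluded by \<open>free_for\<close> where necessary.\<close>

fun tsub :: "(nat \<Rightarrow> ('c, 'f) trm) \<Rightarrow> ('c, 'f) trm \<Rightarrow> ('c, 'f) trm" where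
  "tsub \<sigma> (Var x) = \<sigma> x"
| "tsub \<sigma> (Cst c) = Cst c"
| "tsub \<sigma> (Fun f ts) = Fun f (map (tsub \<sigma>) ts)"

fun fsub :: "(nat \<Rightarrow> ('c, 'f) trm) \<Rightarrow> ('c, 'f, 'p) fm \<Rightarrow> ('c, 'f, 'p) fm" where
  "fsub \<sigma> (Pred P ts) = Pred P (map (tsub \<sigma>) ts)"
| "fsub \<sigma> (Unary h \<phi>) = Unary h (fsub \<sigma> \<phi>)"
| "fsub \<sigma> (Binary h \<phi> \<psi>) = Binary h (fsub \<sigma> \<phi>) (fsub \<sigma> \<psi>)"
| "fsub \<sigma> (Quant Q x \<phi>) = Quant Q x (fsub (\<sigma>(x := Var x)) \<phi>)"

definition subst :: "('c, 'f, 'p) fm \<Rightarrow> nat \<Rightarrow> ('c, 'f) trm \<Rightarrow> ('c, 'f, 'p) fm"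
    (\<open>_\<langle>_ := _\<rangle>\<close> [1000, 51, 51] 1000) where
  "\<phi>\<langle>x := t\<rangle> = fsub (Var(x := t)) \<phi>"

fun free_for :: "('c, 'f) trm \<Rightarrow> nat \<Rightarrow> ('c, 'f, 'p) fm \<Rightarrow> bool" where
  "free_for t x (Pred P ts) \<longleftrightarrow> True"
| "free_for t x (Unary h \<phi>) \<longleftrightarrow> free_for t x \<phi>"
| "free_for t x (Binary h \<phi> \<psi>) \<longleftrightarrow> free_for t x \<phi> \<and> free_for t x \<psi>"
| "free_for t x (Quant Q y \<phi>) \<longleftrightarrow> x = y \<or> (free_for t x \<phi> \<and> (x \<in> FV \<phi> \<longrightarrow> y \<notin> vars t))"

text \<open>Variants: the congruence generated by deletion of void quantifiers and renaming of
  bound variables.  Closing under composition does not affect the calculus or the valuations,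
  since provable implication and equality of values are transitive.\<close>

inductive variant :: "('c, 'f, 'p) fm \<Rightarrow> ('c, 'f, 'p) fm \<Rightarrow> bool" where
  refl: "variant \<phi> \<phi>"
| sym: "variant \<phi> \<psi> \<Longrightarrow> variant \<psi> \<phi>"
| trans: "\<lbrakk>variant \<phi> \<psi>; variant \<psi> \<chi>\<rbrakk> \<Longrightarrow> variant \<phi> \<chi>"
| void: "x \<notin> FV \<phi> \<Longrightarrow> variant (Quant Q x \<phi>) \<phi>"
| rename: "\<lbrakk>y \<notin> FV \<phi>; free_for (Var y) x \<phi>\<rbrakk> \<Longrightarrow> variant (Quant Q x \<phi>) (Quant Q y (\<phi>\<langle>x := Var y\<rangle>))"
| Unary: "variant \<phi> \<phi>' \<Longrightarrow> variant (Unary h \<phi>) (Unary h \<phi>')"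
| Binary: "\<lbrakk>variant \<phi> \<phi>'; variant \<psi> \<psi>'\<rbrakk> \<Longrightarrow> variant (Binary h \<phi> \<psi>) (Binary h \<phi>' \<psi>')"
| Quant: "variant \<phi> \<phi>' \<Longrightarrow> variant (Quant Q x \<phi>) (Quant Q x \<phi>')"

section \<open>The calculus QmbC\<close>

inductive axiom :: "('c, 'f, 'p) fm \<Rightarrow> bool" where
  A1: "axiom (\<alpha> \<^bold>\<longrightarrow> (\<beta> \<^bold>\<longrightarrow> \<alpha>))"
| A2: "axiom ((\<alpha> \<^bold>\<longrightarrow> (\<beta> \<^bold>\<longrightarrow> \<gamma>)) \<^bold>\<longrightarrow> ((\<alpha> \<^bold>\<longrightarrow> \<beta>) \<^bold>\<longrightarrow> (\<alpha> \<^bold>\<longrightarrow> \<gamma>)))"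
| A3: "axiom (\<alpha> \<^bold>\<longrightarrow> (\<beta> \<^bold>\<longrightarrow> (\<alpha> \<^bold>\<and> \<beta>)))"
| A4: "axiom ((\<alpha> \<^bold>\<and> \<beta>) \<^bold>\<longrightarrow> \<alpha>)"
| A5: "axiom ((\<alpha> \<^bold>\<and> \<beta>) \<^bold>\<longrightarrow> \<beta>)"
| A6: "axiom (\<alpha> \<^bold>\<longrightarrow> (\<alpha> \<^bold>\<or> \<beta>))"
| A7: "axiom (\<beta> \<^bold>\<longrightarrow> (\<alpha> \<^bold>\<or> \<beta>))"
| A8: "axiom ((\<alpha> \<^bold>\<longrightarrow> \<gamma>) \<^bold>\<longrightarrow> ((\<beta> \<^bold>\<longrightarrow> \<gamma>) \<^bold>\<longrightarrow> ((\<alpha> \<^bold>\<or> \<beta>) \<^bold>\<longrightarrow> \<gamma>)))"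
| A9: "axiom (\<alpha> \<^bold>\<or> (\<alpha> \<^bold>\<longrightarrow> \<beta>))"
| A10: "axiom (\<alpha> \<^bold>\<or> Neg \<alpha>)"
| A11: "axiom (Circ \<alpha> \<^bold>\<longrightarrow> (\<alpha> \<^bold>\<longrightarrow> (Neg \<alpha> \<^bold>\<longrightarrow> \<beta>)))"
| Ax12: "free_for t x \<phi> \<Longrightarrow> axiom (\<phi>\<langle>x := t\<rangle> \<^bold>\<longrightarrow> Exists x \<phi>)"
| Ax13: "free_for t x \<phi> \<Longrightarrow> axiom (Forall x \<phi> \<^bold>\<longrightarrow> \<phi>\<langle>x := t\<rangle>)"
| Ax14: "variant \<alpha> \<beta> \<Longrightarrow> axiom (\<alpha> \<^bold>\<longrightarrow> \<beta>)"

text \<open>Derivations take place in \<open>For \<Theta>\<close>: in particular the conclusion of every rule, like its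
  premises, is a formula over \<open>\<Theta>\<close>.\<close>

inductive derives :: "('c, 'f, 'p) sig \<Rightarrow> ('c, 'f, 'p) fm set \<Rightarrow> ('c, 'f, 'p) fm \<Rightarrow> bool"
    (\<open>_, _ \<turnstile>QmbC _\<close> [51, 51, 51] 50) for \<Theta> \<Gamma> where
  Ax: "\<lbrakk>\<phi> \<in> For \<Theta>; axiom \<phi>\<rbrakk> \<Longrightarrow> \<Theta>, \<Gamma> \<turnstile>QmbC \<phi>"
| Prem: "\<lbrakk>\<phi> \<in> For \<Theta>; \<phi> \<in> \<Gamma>\<rbrakk> \<Longrightarrow> \<Theta>, \<Gamma> \<turnstile>QmbC \<phi>"
| MP: "\<lbrakk>\<Theta>, \<Gamma> \<turnstile>QmbC \<alpha>; \<Theta>, \<Gamma> \<turnstile>QmbC (\<alpha> \<^bold>\<longrightarrow> \<beta>)\<rbrakk> \<Longrightarrow> \<Theta>, \<Gamma> \<turnstile>QmbC \<beta>"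
| ExIn: "\<lbrakk>\<Theta>, \<Gamma> \<turnstile>QmbC (\<phi> \<^bold>\<longrightarrow> \<psi>); x \<notin> FV \<psi>\<rbrakk> \<Longrightarrow> \<Theta>, \<Gamma> \<turnstile>QmbC (Exists x \<phi> \<^bold>\<longrightarrow> \<psi>)"
| AllIn: "\<lbrakk>\<Theta>, \<Gamma> \<turnstile>QmbC (\<phi> \<^bold>\<longrightarrow> \<psi>); x \<notin> FV \<phi>\<rbrakk> \<Longrightarrow> \<Theta>, \<Gamma> \<turnstile>QmbC (\<phi> \<^bold>\<longrightarrow> Forall x \<psi>)"

section \<open>The Nmatrix M5\<close>

text \<open>The two-element Boolean algebra is \<^typ>\<open>bool\<close>.\<close>

type_synonym tv = "bool \<times> bool \<times> bool"

abbreviation p1 :: "tv \<Rightarrow> bool" where "p1 x \<equiv> fst x"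
abbreviation p2 :: "tv \<Rightarrow> bool" where "p2 x \<equiv> fst (snd x)"
abbreviation p3 :: "tv \<Rightarrow> bool" where "p3 x \<equiv> snd (snd x)"

definition M5 :: "tv set" where
  "M5 = {x. (p1 x \<or> p2 x) \<and> \<not> (p1 x \<and> p2 x \<and> p3 x)}"

definition D5 :: "tv set" where
  "D5 = {x \<in> M5. p1 x}"

fun bool_op :: "binop \<Rightarrow> bool \<Rightarrow> bool \<Rightarrow> bool" where
  "bool_op BAnd a b = (a \<and> b)"
| "bool_op BOr a b = (a \<or> b)"
| "bool_op BImp a b = (a \<longrightarrow> b)"

definition M5_bin :: "binop \<Rightarrow> tv \<Rightarrow> tv \<Rightarrow> tv set" where
  "M5_bin h x y = {z \<in> M5. p1 z = bool_op h (p1 x) (p1 y)}"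

fun M5_un :: "unop \<Rightarrow> tv \<Rightarrow> tv set" where
  "M5_un UNeg x = {z \<in> M5. p1 z = p2 x}"
| "M5_un UCirc x = {z \<in> M5. p1 z = p3 x}"

section \<open>Structures and valuations\<close>

text \<open>An \<open>n\<close>-ary operation is a function on lists, constrained only on lists of length \<open>n\<close> over
  the domain.  The domain is a subset of the type \<open>'u\<close>, so domains of every cardinality up to
  that of \<open>'u\<close> occur; completeness needs \<open>'u\<close> to have room for a domain of closed terms, hence
  a lower bound on its cardinality.\<close>

record ('c, 'f, 'p, 'u) str =
  dm :: "'u set"
  ic :: "'c \<Rightarrow> 'u"
  ifn :: "'f \<Rightarrow> 'u list \<Rightarrow> 'u"
  ipr :: "'p \<Rightarrow> 'u list \<Rightarrow> tv"

definition "structure" :: "('c, 'f, 'p) sig \<Rightarrow> ('c, 'f, 'p, 'u) str \<Rightarrow> bool" where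
  "structure \<Theta> \<AA> \<longleftrightarrow> dm \<AA> \<noteq> {}
    \<and> (\<forall>c\<in>cn \<Theta>. ic \<AA> c \<in> dm \<AA>)
    \<and> (\<forall>n\<ge>1. \<forall>f\<in>fn \<Theta> n. \<forall>as. length as = n \<and> set as \<subseteq> dm \<AA> \<longrightarrow> ifn \<AA> f as \<in> dm \<AA>)
    \<and> (\<forall>n\<ge>1. \<forall>P\<in>pr \<Theta> n. \<forall>as. length as = n \<and> set as \<subseteq> dm \<AA> \<longrightarrow> ipr \<AA> P as \<in> M5)"

text \<open>In the diagram language, \<open>Inl c\<close> is the old constant \<open>c\<close> and \<open>Inr a\<close> the new constant
  naming the element \<open>a\<close>.\<close>

definition diag_sig :: "('c, 'f, 'p) sig \<Rightarrow> 'u set \<Rightarrow> ('c + 'u, 'f, 'p) sig" where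
  "diag_sig \<Theta> U = \<lparr>cn = cn \<Theta> <+> U, fn = fn \<Theta>, pr = pr \<Theta>\<rparr>"

definition diag_str :: "('c, 'f, 'p, 'u) str \<Rightarrow> ('c + 'u, 'f, 'p, 'u) str" where
  "diag_str \<AA> = \<lparr>dm = dm \<AA>, ic = case_sum (ic \<AA>) (\<lambda>a. a), ifn = ifn \<AA>, ipr = ipr \<AA>\<rparr>"

abbreviation name :: "'u \<Rightarrow> ('c + 'u, 'f) trm" where
  "name a \<equiv> Cst (Inr a)"

definition embed :: "('c, 'f, 'p) fm \<Rightarrow> ('c + 'u, 'f, 'p) fm" where
  "embed = map_fm Inl (\<lambda>f. f) (\<lambda>P. P)"

definition assignment :: "('c, 'f, 'p, 'u) str \<Rightarrow> (nat \<Rightarrow> 'u) \<Rightarrow> bool" where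
  "assignment \<AA> \<mu> \<longleftrightarrow> (\<forall>x. \<mu> x \<in> dm \<AA>)"

fun val :: "('c, 'f, 'p, 'u) str \<Rightarrow> (nat \<Rightarrow> 'u) \<Rightarrow> ('c, 'f) trm \<Rightarrow> 'u" where
  "val \<AA> \<mu> (Var x) = \<mu> x"
| "val \<AA> \<mu> (Cst c) = ic \<AA> c"
| "val \<AA> \<mu> (Fun f ts) = ifn \<AA> f (map (val \<AA> \<mu>) ts)"

definition inst :: "(nat \<Rightarrow> 'u) \<Rightarrow> ('c + 'u, 'f, 'p) fm \<Rightarrow> ('c + 'u, 'f, 'p) fm" where
  "inst \<mu> = fsub (\<lambda>x. name (\<mu> x))"

text \<open>A valuation is a total function on the type of formulas, constrained only on the
  sentences of the diagram language.  In an atomic sentence the terms are closed, so the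
  assignment \<open>\<mu>\<close> is immaterial.\<close>

definition valuation ::
    "('c, 'f, 'p) sig \<Rightarrow> ('c, 'f, 'p, 'u) str \<Rightarrow> (('c + 'u, 'f, 'p) fm \<Rightarrow> tv) \<Rightarrow> bool" where
  "valuation \<Theta> \<AA> v \<longleftrightarrow> (let U = dm \<AA>; S = Sen (diag_sig \<Theta> U); F = For (diag_sig \<Theta> U);
      T = Ter (diag_sig \<Theta> U); \<AA>' = diag_str \<AA> in
    (\<forall>\<phi>\<in>S. v \<phi> \<in> M5)
    \<and> (\<forall>P ts \<mu>. Pred P ts \<in> S \<and> assignment \<AA> \<mu> \<longrightarrow> v (Pred P ts) = ipr \<AA> P (map (val \<AA>' \<mu>) ts))
    \<and> (\<forall>h. \<forall>\<phi>\<in>S. v (Unary h \<phi>) \<in> M5_un h (v \<phi>))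
    \<and> (\<forall>h. \<forall>\<phi>\<in>S. \<forall>\<psi>\<in>S. v (Binary h \<phi> \<psi>) \<in> M5_bin h (v \<phi>) (v \<psi>))
    \<and> (\<forall>x \<phi>. Forall x \<phi> \<in> S \<longrightarrow> p1 (v (Forall x \<phi>)) = (\<forall>a\<in>U. p1 (v (\<phi>\<langle>x := name a\<rangle>))))
    \<and> (\<forall>x \<phi>. Exists x \<phi> \<in> S \<longrightarrow> p1 (v (Exists x \<phi>)) = (\<exists>a\<in>U. p1 (v (\<phi>\<langle>x := name a\<rangle>))))
    \<and> (\<forall>t\<in>T. \<forall>z \<mu> b. assignment \<AA> \<mu> \<and> b = val \<AA>' \<mu> t \<longrightarrow>
        (\<forall>h. \<forall>\<phi>\<in>F. free_for t z \<phi>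
          \<and> v (inst \<mu> (\<phi>\<langle>z := t\<rangle>)) = v (inst \<mu> (\<phi>\<langle>z := name b\<rangle>))
          \<longrightarrow> v (inst \<mu> ((Unary h \<phi>)\<langle>z := t\<rangle>)) = v (inst \<mu> ((Unary h \<phi>)\<langle>z := name b\<rangle>)))
      \<and> (\<forall>h. \<forall>\<phi>\<in>F. \<forall>\<psi>\<in>F. free_for t z \<phi> \<and> free_for t z \<psi>
          \<and> v (inst \<mu> (\<phi>\<langle>z := t\<rangle>)) = v (inst \<mu> (\<phi>\<langle>z := name b\<rangle>))
          \<and> v (inst \<mu> (\<psi>\<langle>z := t\<rangle>)) = v (inst \<mu> (\<psi>\<langle>z := name b\<rangle>))
          \<longrightarrow> v (inst \<mu> ((Binary h \<phi> \<psi>)\<langle>z := t\<rangle>)) = v (inst \<mu> ((Binary h \<phi> \<psi>)\<langle>z := name b\<rangle>)))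
      \<and> (\<forall>Q x. \<forall>\<phi>\<in>F. free_for t z \<phi> \<and> x \<noteq> z \<and> x \<notin> vars t
          \<and> (\<forall>a\<in>U. v (inst (\<mu>(x := a)) (\<phi>\<langle>z := t\<rangle>)) = v (inst (\<mu>(x := a)) (\<phi>\<langle>z := name b\<rangle>)))
          \<longrightarrow> v (inst \<mu> ((Quant Q x \<phi>)\<langle>z := t\<rangle>)) = v (inst \<mu> ((Quant Q x \<phi>)\<langle>z := name b\<rangle>))))
    \<and> (\<forall>\<phi>\<in>S. \<forall>\<phi>'\<in>S. variant \<phi> \<phi>' \<longrightarrow> v \<phi> = v \<phi>'))"

definition consequence ::
    "('c, 'f, 'p) sig \<Rightarrow> ('c, 'f, 'p, 'u) str \<Rightarrow> ('c, 'f, 'p) fm set \<Rightarrow> ('c, 'f, 'p) fm \<Rightarrow> bool" where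
  "consequence \<Theta> \<AA> \<Gamma> \<phi> \<longleftrightarrow> (\<forall>v. valuation \<Theta> \<AA> v \<longrightarrow>
    (\<forall>\<gamma>\<in>\<Gamma>. \<forall>\<mu>. assignment \<AA> \<mu> \<longrightarrow> v (inst \<mu> (embed \<gamma>)) \<in> D5) \<longrightarrow>
    (\<forall>\<mu>. assignment \<AA> \<mu> \<longrightarrow> v (inst \<mu> (embed \<phi>)) \<in> D5))"

end

theory Submission
  imports Defs
begin

text \<open>Soundness: by (vi), replacing a term by the name of its value does not change values, and
  variants are stable under replacing variables by names; the rest is a check of the axioms.

  Completeness: the language is extended by a witnessing constant for each of its own quantified
  formulas.  The witnessing axioms are conservative, since a constant of maximal nesting depth can
  be replaced by a fresh variable.  A set \<open>K\<close> that is maximal among those not deriving the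
  sentence \<open>\<chi>\<close> proves \<open>\<alpha>\<close> or \<open>\<alpha> \<rightarrow> \<chi>\<close> for every sentence \<open>\<alpha>\<close>, and by (A9) this already makes
  provability from \<open>K\<close> commute with the connectives, without a classical negation.  The closed terms
  form the domain, and a sentence \<open>\<alpha>\<close> receives the triple of truth values of \<open>K \<turnstile> \<alpha>\<close>, \<open>K \<turnstile> \<not>\<alpha>\<close>,
  \<open>K \<turnstile> \<circ>\<alpha>\<close>.  As the extended language has no more closed terms than the original one has formulas,
  this domain fits into the type given.\<close>

section \<open>Substitution\<close>

\<comment> \<open>The matrix is non-deterministic: the values of the parts do not determine the
  value of the whole. A substitution lemma therefore cannot come from compositionality; (vi) is its
  induction step, imposed on valuations.

  The quantifier rules inspect free variables, so the deduction theorem is confined to sentences,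
  and an open formula is closed universally before completeness is applied. In the maximality
  argument the unprovable \<chi> plays falsum and \<alpha> \<rightarrow> \<chi> plays negation.
  Universal formulas get witnessing axioms of their own, whose constant names a possible
  counterexample, instead of being traded for existential ones.

  \<Theta> may have any cardinality. Hence the maximal set comes from Zorn's lemma, and a witnessing
  constant is a syntax tree containing the formula it serves, so that no enumeration occurs.\<close>
inductive_simps Ter_simps [simp]:
  "Var x \<in> Ter \<Theta>" "Cst c \<in> Ter \<Theta>" "Fun f ts \<in> Ter \<Theta>"

inductive_simps For_simps [simp]:
  "Pred P ts \<in> For \<Theta>" "Unary h \<phi> \<in> For \<Theta>" "Binary h \<phi> \<psi> \<in> For \<Theta>" "Quant Q x \<phi> \<in> For \<Theta>"

lemma tsub_cong: "(\<And>x. x \<in> vars t \<Longrightarrow> \<sigma> x = \<tau> x) \<Longrightarrow> tsub \<sigma> t = tsub \<tau> t"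
  by (induction t) auto

lemma fsub_cong: "(\<And>x. x \<in> FV \<phi> \<Longrightarrow> \<sigma> x = \<tau> x) \<Longrightarrow> fsub \<sigma> \<phi> = fsub \<tau> \<phi>"
proof (induction \<phi> arbitrary: \<sigma> \<tau>)
  case (Pred P ts)
  then show ?case by (auto intro!: tsub_cong)
next
  case (Binary h \<phi> \<psi>)
  have "fsub \<sigma> \<phi> = fsub \<tau> \<phi>" "fsub \<sigma> \<psi> = fsub \<tau> \<psi>"
    by (rule Binary; simp add: Binary.prems)+
  then show ?case by simp
next
  case (Quant Q y \<phi>)
  have "fsub (\<sigma>(y := Var y)) \<phi> = fsub (\<tau>(y := Var y)) \<phi>"
    by (rule Quant.IH) (simp add: Quant.prems)
  then show ?case by simp
next
  case (Unary h \<phi>)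
  have "fsub \<sigma> \<phi> = fsub \<tau> \<phi>" by (rule Unary; simp add: Unary.prems)
  then show ?case by simp
qed

lemma tsub_Var [simp]: "tsub Var t = t"
  by (induction t) (auto intro: map_idI)

lemma fsub_Var [simp]: "fsub Var \<phi> = \<phi>"
  by (induction \<phi>) (auto intro: map_idI)

lemma fsub_closed: "FV \<phi> = {} \<Longrightarrow> fsub \<sigma> \<phi> = \<phi>"
  using fsub_cong[of \<phi> \<sigma> Var] by simp

lemma tsub_closed: "vars t = {} \<Longrightarrow> tsub \<sigma> t = t"
  using tsub_cong[of t \<sigma> Var] by simp

lemma subst_self [simp]: "\<phi>\<langle>x := Var x\<rangle> = \<phi>"
  by (simp add: subst_def)

lemma subst_not_free: "x \<notin> FV \<phi> \<Longrightarrow> \<phi>\<langle>x := t\<rangle> = \<phi>"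
  unfolding subst_def by (subst fsub_cong[where \<tau> = Var]) auto

lemma subst_simps [simp]:
  "(Unary h \<phi>)\<langle>x := t\<rangle> = Unary h (\<phi>\<langle>x := t\<rangle>)"
  "(Binary g \<phi> \<psi>)\<langle>x := t\<rangle> = Binary g (\<phi>\<langle>x := t\<rangle>) (\<psi>\<langle>x := t\<rangle>)"
  "y \<noteq> x \<Longrightarrow> (Quant Q y \<phi>)\<langle>x := t\<rangle> = Quant Q y (\<phi>\<langle>x := t\<rangle>)"
  by (auto simp: subst_def fun_upd_twist intro: fsub_cong)

lemma free_for_closed: "vars t = {} \<Longrightarrow> free_for t x \<phi>"
  by (induction \<phi>) auto

lemma free_for_self: "free_for (Var x) x \<phi>"
  by (induction \<phi>) auto

lemma vars_tsub: "vars (tsub \<sigma> t) = (\<Union>x\<in>vars t. vars (\<sigma> x))"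
  by (induction t) auto

lemma tsub_tsub: "tsub \<sigma> (tsub \<tau> t) = tsub (tsub \<sigma> \<circ> \<tau>) t"
  by (induction t) auto

lemma tsub_Ter: "t \<in> Ter \<Theta> \<Longrightarrow> (\<And>x. \<sigma> x \<in> Ter \<Theta>) \<Longrightarrow> tsub \<sigma> t \<in> Ter \<Theta>"
  by (induction rule: Ter.induct) auto

lemma fsub_For: "\<phi> \<in> For \<Theta> \<Longrightarrow> (\<And>x. \<sigma> x \<in> Ter \<Theta>) \<Longrightarrow> fsub \<sigma> \<phi> \<in> For \<Theta>"
  by (induction arbitrary: \<sigma> rule: For.induct) (auto simp: tsub_Ter)

lemma subst_For: "\<phi> \<in> For \<Theta> \<Longrightarrow> t \<in> Ter \<Theta> \<Longrightarrow> \<phi>\<langle>x := t\<rangle> \<in> For \<Theta>"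
  unfolding subst_def by (erule fsub_For) auto

lemma tsub_Ter_D: "tsub \<sigma> t \<in> Ter \<Theta> \<Longrightarrow> x \<in> vars t \<Longrightarrow> \<sigma> x \<in> Ter \<Theta>"
  by (induction t) auto

text \<open>Recovers that the term in an instance of Ax12 or Ax13 lies in the language whenever the
  replaced variable is really free; derivations only require this of the resulting formula.\<close>

lemma fsub_For_D: "fsub \<sigma> \<phi> \<in> For \<Theta> \<Longrightarrow> x \<in> FV \<phi> \<Longrightarrow> \<sigma> x \<in> Ter \<Theta>"
proof (induction \<phi> arbitrary: \<sigma>)
  case (Pred P ts)
  then show ?case by (auto intro: tsub_Ter_D)
next
  case (Quant Q y \<phi>)
  then show ?case using Quant.IH[of "\<sigma>(y := Var y)"] by (auto simp: fun_upd_def)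
qed auto

text \<open>Where \<open>z\<close> is free below a quantifier, freeness keeps the bound variable out
  of \<open>t\<close>, so protecting that variable does not change \<open>tsub \<sigma> t\<close>.
  The substitution \<sigma> is arbitrary because any capture it causes happens alike on both
  sides.\<close>

lemma fsub_subst:
  "free_for t z \<phi> \<Longrightarrow> fsub \<sigma> (\<phi>\<langle>z := t\<rangle>) = fsub (\<sigma>(z := tsub \<sigma> t)) \<phi>"
proof (induction \<phi> arbitrary: \<sigma>)
  case (Pred P ts)
  show ?case by (auto simp: subst_def tsub_tsub intro!: tsub_cong)
next
  case (Quant Q y \<phi>)
  show ?case
  proof (cases "y = z \<or> z \<notin> FV \<phi>")
    case True
    then have "z \<notin> FV (Quant Q y \<phi>)" by auto
    then show ?thesis
      by (subst subst_not_free, assumption) (rule fsub_cong, auto)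
  next
    case False
    then have "y \<notin> vars t" "free_for t z \<phi>" using Quant.prems by auto
    then have "tsub (\<sigma>(y := Var y)) t = tsub \<sigma> t"
      by (auto intro!: tsub_cong)
    with Quant.IH[OF \<open>free_for t z \<phi>\<close>, of "\<sigma>(y := Var y)"] False show ?thesis
      by (auto simp: fun_upd_def intro!: fsub_cong)
  qed
qed simp_all

text \<open>Such substitutions never capture, and unlike those with closed values only, they are
  stable under the protection of a bound variable that \<open>fsub\<close> performs at a
  quantifier.\<close>

definition ground :: "(nat \<Rightarrow> ('c, 'f) trm) \<Rightarrow> bool" where
  "ground \<sigma> \<longleftrightarrow> (\<forall>x. \<sigma> x = Var x \<or> vars (\<sigma> x) = {})"

lemma ground_upd: "ground \<sigma> \<Longrightarrow> ground (\<sigma>(x := Var x))"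
  by (auto simp: ground_def)

lemma ground_closed: "(\<And>x. vars (\<sigma> x) = {}) \<Longrightarrow> ground \<sigma>"
  by (auto simp: ground_def)

text \<open>Below a binder \<open>y\<close>, the substitution \<sigma> is blocked at
  \<open>y\<close>. This does no harm because \<tau> sends every other variable to itself or to a
  closed term, never to something containing \<open>y\<close>.\<close>

lemma fsub_fsub:
  "ground \<tau> \<Longrightarrow> fsub \<sigma> (fsub \<tau> \<phi>) = fsub (tsub \<sigma> \<circ> \<tau>) \<phi>"
proof (induction \<phi> arbitrary: \<sigma> \<tau>)
  case (Pred P ts)
  show ?case by (auto simp: tsub_tsub o_def)
next
  case (Quant Q y \<phi>)
  have "tsub (\<sigma>(y := Var y)) \<circ> \<tau>(y := Var y) = (tsub \<sigma> \<circ> \<tau>)(y := Var y)"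
  proof
    fix x
    show "(tsub (\<sigma>(y := Var y)) \<circ> \<tau>(y := Var y)) x = ((tsub \<sigma> \<circ> \<tau>)(y := Var y)) x"
      using Quant.prems unfolding ground_def
      by (cases "x = y") (auto simp: tsub_closed dest!: spec[of _ x])
  qed
  then show ?case
    using Quant.IH[OF ground_upd[OF Quant.prems], of "\<sigma>(y := Var y)" y]
    by (simp add: fun_upd_def o_def)
qed simp_all

lemma FV_fsub: "ground \<sigma> \<Longrightarrow> FV (fsub \<sigma> \<phi>) = {x \<in> FV \<phi>. vars (\<sigma> x) \<noteq> {}}"
proof (induction \<phi> arbitrary: \<sigma>)
  case (Pred P ts)
  then show ?case unfolding ground_def
    by (auto simp: vars_tsub) (metis empty_iff singletonD vars.simps(1))+
next
  case (Quant Q y \<phi>)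
  then show ?case
    using Quant.IH[OF ground_upd[OF Quant.prems], of y] by (auto simp: fun_upd_def)
qed auto

lemma FV_subst_closed: "vars t = {} \<Longrightarrow> FV (\<phi>\<langle>x := t\<rangle>) = FV \<phi> - {x}"
  unfolding subst_def by (subst FV_fsub) (auto simp: ground_def)

text \<open>Lets clauses (iv) and (v) be read in terms of updated assignments: below the quantifier
  \<open>x\<close> was protected, so it is the only variable still to be replaced.\<close>

lemma subst_fsub_upd:
  assumes "\<And>y. vars (\<sigma> y) = {}"
  shows "(fsub (\<sigma>(x := Var x)) \<phi>)\<langle>x := t\<rangle> = fsub (\<sigma>(x := t)) \<phi>"
proof -
  have "ground (\<sigma>(x := Var x))" using assms by (auto simp: ground_def)
  then show ?thesis
    unfolding subst_def using assms by (auto simp: fsub_fsub tsub_closed intro!: fsub_cong)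
qed

lemma free_for_fsub: "ground \<sigma> \<Longrightarrow> free_for t x \<phi> \<Longrightarrow> free_for t x (fsub \<sigma> \<phi>)"
  by (induction \<phi> arbitrary: \<sigma>) (auto simp: ground_upd FV_fsub)

text \<open>Clause (vii) is about sentences while Ax14 is about formulas; this bridges the two. A
  ground substitution adds no free variables, so a void quantifier stays void and the new name of a
  bound variable stays fresh.\<close>

lemma variant_fsub:
  "variant \<phi> \<psi> \<Longrightarrow> ground \<sigma> \<Longrightarrow> variant (fsub \<sigma> \<phi>) (fsub \<sigma> \<psi>)"
proof (induction arbitrary: \<sigma> rule: variant.induct)
  case (trans \<phi> \<psi> \<chi>)
  then show ?case by (blast intro: variant.trans)
next
  case (void x \<phi> Q)
  then have "fsub (\<sigma>(x := Var x)) \<phi> = fsub \<sigma> \<phi>" by (auto intro!: fsub_cong)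
  moreover have "x \<notin> FV (fsub \<sigma> \<phi>)" using void by (simp add: FV_fsub)
  ultimately show ?case by (simp add: variant.void)
next
  case (rename y \<phi> x Q)
  let ?\<phi> = "fsub (\<sigma>(x := Var x)) \<phi>"
  have g: "ground (\<sigma>(x := Var x))" using rename.prems by (rule ground_upd)
  have "fsub (\<sigma>(y := Var y)) (\<phi>\<langle>x := Var y\<rangle>) = ?\<phi>\<langle>x := Var y\<rangle>"
    using rename.prems rename.hyps(1) unfolding fsub_subst[OF rename.hyps(2)]
    unfolding subst_def fsub_fsub[OF g] ground_def
    by (intro fsub_cong) (auto simp: tsub_closed, metis fun_upd_other tsub.simps(1) tsub_closed)
  moreover have "y \<notin> FV ?\<phi>" using rename.hyps(1) FV_fsub[OF g] by auto
  ultimately show ?case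
    using variant.rename[of y ?\<phi> x Q] free_for_fsub[OF g rename.hyps(2)] by simp
next
  case (Quant \<phi> \<phi>' Q x)
  show ?case using Quant.IH[OF ground_upd[OF Quant.prems]] by (simp add: variant.Quant fun_upd_def)
qed (auto intro: variant.intros)

section \<open>Replacing constants by terms\<close>

fun tcs :: "('c \<Rightarrow> ('d, 'f) trm) \<Rightarrow> ('c, 'f) trm \<Rightarrow> ('d, 'f) trm" where
  "tcs \<theta> (Var x) = Var x"
| "tcs \<theta> (Cst c) = \<theta> c"
| "tcs \<theta> (Fun f ts) = Fun f (map (tcs \<theta>) ts)"

fun fcs :: "('c \<Rightarrow> ('d, 'f) trm) \<Rightarrow> ('c, 'f, 'p) fm \<Rightarrow> ('d, 'f, 'p) fm" where
  "fcs \<theta> (Pred P ts) = Pred P (map (tcs \<theta>) ts)"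
| "fcs \<theta> (Unary h \<phi>) = Unary h (fcs \<theta> \<phi>)"
| "fcs \<theta> (Binary h \<phi> \<psi>) = Binary h (fcs \<theta> \<phi>) (fcs \<theta> \<psi>)"
| "fcs \<theta> (Quant Q x \<phi>) = Quant Q x (fcs \<theta> \<phi>)"

text \<open>The guard against capture: a constant replaced by an open term may sit below a
  quantifier, and \<open>N\<close> lists the variables that could do harm there.\<close>

definition avoids :: "('c \<Rightarrow> ('d, 'f) trm) \<Rightarrow> nat set \<Rightarrow> bool" where
  "avoids \<theta> N \<longleftrightarrow> (\<forall>c. vars (\<theta> c) \<inter> N = {})"

lemma avoids_Un [simp]: "avoids \<theta> (M \<union> N) \<longleftrightarrow> avoids \<theta> M \<and> avoids \<theta> N"
  by (auto simp: avoids_def)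

lemma avoids_closed: "(\<And>c. vars (\<theta> c) = {}) \<Longrightarrow> avoids \<theta> N"
  by (simp add: avoids_def)

lemma vars_tcs: "vars (tcs \<theta> t) \<inter> N = vars t \<inter> N" if "avoids \<theta> N"
  using that by (induction t) (auto simp: avoids_def)

text \<open>The replacement \<theta> may bring in variables outside \<open>N\<close>, so free
  variables can be compared on \<open>N\<close> only.\<close>

lemma FV_fcs: "avoids \<theta> N \<Longrightarrow> FV (fcs \<theta> \<phi>) \<inter> N = FV \<phi> \<inter> N"
proof (induction \<phi>)
  case (Pred P ts)
  then show ?case using vars_tcs[of \<theta> N] by auto
qed auto

lemma FV_fcs_iff: "avoids \<theta> N \<Longrightarrow> x \<in> N \<Longrightarrow> x \<in> FV (fcs \<theta> \<phi>) \<longleftrightarrow> x \<in> FV \<phi>"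
  using FV_fcs[of \<theta> N \<phi>] by auto

lemma FV_fcs_closed: "(\<And>c. vars (\<theta> c) = {}) \<Longrightarrow> FV (fcs \<theta> \<phi>) = FV \<phi>"
  using FV_fcs[OF avoids_closed, of \<theta> \<phi> UNIV] by auto

text \<open>On the right the substitution also meets the variables brought in by \<theta>, which it
  never saw on the left; hence it has to fix them.\<close>

lemma tcs_tsub:
  "(\<And>c y. y \<in> vars (\<theta> c) \<Longrightarrow> \<sigma> y = Var y) \<Longrightarrow> tcs \<theta> (tsub \<sigma> t) = tsub (tcs \<theta> \<circ> \<sigma>) (tcs \<theta> t)"
proof (induction t)
  case (Cst c)
  have "tsub (tcs \<theta> \<circ> \<sigma>) (\<theta> c) = tsub Var (\<theta> c)" by (rule tsub_cong) (simp add: Cst)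
  then show ?case by (simp add: o_def)
qed auto

lemma fcs_fsub:
  "(\<And>c y. y \<in> vars (\<theta> c) \<Longrightarrow> \<sigma> y = Var y) \<Longrightarrow> fcs \<theta> (fsub \<sigma> \<phi>) = fsub (tcs \<theta> \<circ> \<sigma>) (fcs \<theta> \<phi>)"
proof (induction \<phi> arbitrary: \<sigma>)
  case (Pred P ts)
  then show ?case by (auto simp: tcs_tsub o_def)
next
  case (Quant Q x \<phi>)
  have "fcs \<theta> (fsub (\<sigma>(x := Var x)) \<phi>) = fsub (tcs \<theta> \<circ> \<sigma>(x := Var x)) (fcs \<theta> \<phi>)"
    by (rule Quant.IH) (simp add: Quant.prems)
  moreover have "tcs \<theta> \<circ> \<sigma>(x := Var x) = (tcs \<theta> \<circ> \<sigma>)(x := Var x)" by auto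
  ultimately show ?case by (simp add: o_def)
qed simp_all

lemma fcs_subst:
  "(\<And>c. x \<notin> vars (\<theta> c)) \<Longrightarrow> fcs \<theta> (\<phi>\<langle>x := t\<rangle>) = (fcs \<theta> \<phi>)\<langle>x := tcs \<theta> t\<rangle>"
  unfolding subst_def by (subst fcs_fsub) (auto intro!: arg_cong[where f = "\<lambda>s. fsub s _"])

lemma tcs_tcs: "tcs \<theta> (tcs \<eta> t) = tcs (tcs \<theta> \<circ> \<eta>) t"
  by (induction t) auto

lemma fcs_fcs: "fcs \<theta> (fcs \<eta> \<phi>) = fcs (tcs \<theta> \<circ> \<eta>) \<phi>"
  by (induction \<phi>) (auto simp: tcs_tcs o_def)

lemma tcs_cong: "(\<And>c. c \<in> set1_trm t \<Longrightarrow> \<theta> c = \<eta> c) \<Longrightarrow> tcs \<theta> t = tcs \<eta> t"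
  by (induction t) auto

lemma fcs_cong: "(\<And>c. c \<in> set1_fm \<phi> \<Longrightarrow> \<theta> c = \<eta> c) \<Longrightarrow> fcs \<theta> \<phi> = fcs \<eta> \<phi>"
  by (induction \<phi>) (auto intro!: tcs_cong)

lemma tcs_Cst [simp]: "tcs Cst t = t"
  by (induction t) (auto intro: map_idI)

lemma fcs_Cst [simp]: "fcs Cst \<phi> = \<phi>"
  by (induction \<phi>) (auto intro: map_idI)

lemma tcs_Ter:
  "t \<in> Ter \<Theta> \<Longrightarrow> fn \<Theta>' = fn \<Theta> \<Longrightarrow> (\<And>c. c \<in> cn \<Theta> \<Longrightarrow> \<theta> c \<in> Ter \<Theta>') \<Longrightarrow> tcs \<theta> t \<in> Ter \<Theta>'"
  by (induction rule: Ter.induct) auto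

lemma fcs_For:
  "\<phi> \<in> For \<Theta> \<Longrightarrow> fn \<Theta>' = fn \<Theta> \<Longrightarrow> pr \<Theta>' = pr \<Theta> \<Longrightarrow> (\<And>c. c \<in> cn \<Theta> \<Longrightarrow> \<theta> c \<in> Ter \<Theta>')
    \<Longrightarrow> fcs \<theta> \<phi> \<in> For \<Theta>'"
  by (induction rule: For.induct) (auto intro: tcs_Ter)

fun BV :: "('c, 'f, 'p) fm \<Rightarrow> nat set" where
  "BV (Pred P ts) = {}"
| "BV (Unary h \<phi>) = BV \<phi>"
| "BV (Binary h \<phi> \<psi>) = BV \<phi> \<union> BV \<psi>"
| "BV (Quant Q x \<phi>) = insert x (BV \<phi>)"

lemma finite_BV [simp]: "finite (BV \<phi>)"
  by (induction \<phi>) auto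

lemma finite_vars [simp]: "finite (vars t)"
  by (induction t) auto

lemma finite_FV [simp]: "finite (FV \<phi>)"
  by (induction \<phi>) auto

lemma free_for_fcs:
  "avoids \<theta> (insert x (BV \<phi>)) \<Longrightarrow> free_for t x \<phi> \<Longrightarrow> free_for (tcs \<theta> t) x (fcs \<theta> \<phi>)"
proof (induction \<phi>)
  case (Quant Q y \<phi>)
  have "avoids \<theta> (insert x (BV \<phi>))" using Quant.prems(1) by (auto simp: avoids_def)
  moreover have "avoids \<theta> {x, y}" using Quant.prems(1) by (auto simp: avoids_def)
  ultimately show ?case
    using Quant.IH Quant.prems FV_fcs_iff[of \<theta> "{x, y}" x \<phi>] vars_tcs[of \<theta> "{x, y}" t] by auto
next
  case (Binary h \<phi> \<psi>)
  then show ?case by (auto simp: avoids_def)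
qed auto

text \<open>The set \<open>N\<close> is existential because transitivity passes through formulas
  that cannot be read off the two ends, and their bound variables have to be avoided as
  well.\<close>

lemma variant_fcs_aux:
  fixes \<phi> \<psi> :: "('c, 'f, 'p) fm"
  assumes "variant \<phi> \<psi>"
  shows "\<exists>N. finite N \<and>
    (\<forall>\<theta> :: 'c \<Rightarrow> ('d, 'f) trm. avoids \<theta> N \<longrightarrow> variant (fcs \<theta> \<phi>) (fcs \<theta> \<psi>))"
  using assms
proof (induction rule: variant.induct)
  case (refl \<phi>)
  show ?case by (auto intro: variant.refl)
next
  case (sym \<phi> \<psi>)
  then show ?case by (blast intro: variant.sym)
next
  case (trans \<phi> \<psi> \<chi>)
  then obtain M N where "finite M" "finite N"
    "\<forall>\<theta> :: 'c \<Rightarrow> ('d, 'f) trm. avoids \<theta> M \<longrightarrow> variant (fcs \<theta> \<phi>) (fcs \<theta> \<psi>)"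
    "\<forall>\<theta> :: 'c \<Rightarrow> ('d, 'f) trm. avoids \<theta> N \<longrightarrow> variant (fcs \<theta> \<psi>) (fcs \<theta> \<chi>)" by blast
  then show ?case by (intro exI[of _ "M \<union> N"]) (auto intro: variant.trans)
next
  case (void x \<phi> Q)
  have "variant (fcs \<theta> (Quant Q x \<phi>)) (fcs \<theta> \<phi>)"
    if "avoids \<theta> {x}" for \<theta> :: "'c \<Rightarrow> ('d, 'f) trm"
    using FV_fcs_iff[OF that, of x \<phi>] void by (auto intro: variant.void)
  then show ?case by (intro exI[of _ "{x}"]) simp
next
  case (rename y \<phi> x Q)
  have "variant (fcs \<theta> (Quant Q x \<phi>)) (fcs \<theta> (Quant Q y (\<phi>\<langle>x := Var y\<rangle>)))"
    if a: "avoids \<theta> ({x, y} \<union> BV \<phi>)" for \<theta> :: "'c \<Rightarrow> ('d, 'f) trm"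
  proof -
    have "y \<notin> FV (fcs \<theta> \<phi>)" using FV_fcs_iff[OF a, of y \<phi>] rename.hyps by simp
    moreover have "avoids \<theta> (insert x (BV \<phi>))" using a by (auto simp: avoids_def)
    then have "free_for (Var y) x (fcs \<theta> \<phi>)" using free_for_fcs rename.hyps(2) by fastforce
    moreover have "x \<notin> vars (\<theta> c)" for c using a by (auto simp: avoids_def)
    ultimately show ?thesis using variant.rename[of y "fcs \<theta> \<phi>" x Q] by (simp add: fcs_subst)
  qed
  then show ?case by (intro exI[of _ "{x, y} \<union> BV \<phi>"]) (auto simp del: avoids_Un)
next
  case (Binary \<phi> \<phi>' \<psi> \<psi>' h)
  then obtain M N where "finite M" "finite N"
    "\<forall>\<theta> :: 'c \<Rightarrow> ('d, 'f) trm. avoids \<theta> M \<longrightarrow> variant (fcs \<theta> \<phi>) (fcs \<theta> \<phi>')"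
    "\<forall>\<theta> :: 'c \<Rightarrow> ('d, 'f) trm. avoids \<theta> N \<longrightarrow> variant (fcs \<theta> \<psi>) (fcs \<theta> \<psi>')" by blast
  then show ?case by (intro exI[of _ "M \<union> N"]) (auto intro: variant.Binary)
next
  case (Unary \<phi> \<phi>' h)
  then show ?case by (auto intro: variant.Unary)
next
  case (Quant \<phi> \<phi>' Q x)
  then show ?case by (auto intro: variant.Quant)
qed

lemma variant_fcs:
  assumes "variant \<phi> \<psi>" and "\<And>c. vars (\<theta> c) = {}"
  shows "variant (fcs \<theta> \<phi>) (fcs \<theta> \<psi>)"
  using variant_fcs_aux[OF assms(1)] avoids_closed[of \<theta>] assms(2) by blast

lemma axiom_fcs:
  fixes \<phi> :: "('c, 'f, 'p) fm"
  assumes "axiom \<phi>"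
  shows "\<exists>N. finite N \<and> (\<forall>\<theta> :: 'c \<Rightarrow> ('d, 'f) trm. avoids \<theta> N \<longrightarrow> axiom (fcs \<theta> \<phi>))"
  using assms
proof (cases rule: axiom.cases)
  case (Ax12 t x \<psi>)
  have "axiom (fcs \<theta> \<phi>)" if a: "avoids \<theta> (insert x (BV \<psi>))" for \<theta> :: "'c \<Rightarrow> ('d, 'f) trm"
    using axiom.Ax12[OF free_for_fcs[OF a]] Ax12 a by (simp add: fcs_subst avoids_def)
  then show ?thesis by (intro exI[of _ "insert x (BV \<psi>)"]) simp
next
  case (Ax13 t x \<psi>)
  have "axiom (fcs \<theta> \<phi>)" if a: "avoids \<theta> (insert x (BV \<psi>))" for \<theta> :: "'c \<Rightarrow> ('d, 'f) trm"
    using axiom.Ax13[OF free_for_fcs[OF a]] Ax13 a by (simp add: fcs_subst avoids_def)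
  then show ?thesis by (intro exI[of _ "insert x (BV \<psi>)"]) simp
next
  case (Ax14 \<alpha> \<beta>)
  then show ?thesis using variant_fcs_aux[OF Ax14(2)] by (auto intro: axiom.Ax14)
qed (simp; rule exI[of _ "{}"]; simp add: axiom.intros)+

text \<open>A derivation involves finitely many variables, and a replacement that stays clear of
  them can be applied to every line. One \<open>N\<close> serves all \<theta>, so the variable that
  is to replace a constant can be chosen after the derivation is known.\<close>

lemma derives_fcs:
  fixes \<Theta> :: "('c, 'f, 'p) sig" and \<Theta>' :: "('d, 'f, 'p) sig"
  assumes "\<Theta>, \<Gamma> \<turnstile>QmbC \<phi>" and sig: "fn \<Theta>' = fn \<Theta>" "pr \<Theta>' = pr \<Theta>"
  shows "\<exists>N. finite N \<and> (\<forall>\<theta>. avoids \<theta> N \<and> (\<forall>c\<in>cn \<Theta>. \<theta> c \<in> Ter \<Theta>')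
    \<longrightarrow> \<Theta>', fcs \<theta> ` \<Gamma> \<turnstile>QmbC fcs \<theta> \<phi>)"
  using assms(1)
proof (induction rule: derives.induct)
  case (Ax \<phi>)
  then show ?case using axiom_fcs[OF Ax(2)] fcs_For[OF Ax(1) sig] by (meson derives.Ax)
next
  case (Prem \<phi>)
  then show ?case using fcs_For[OF Prem(1) sig]
    by (intro exI[of _ "{}"]) (blast intro: derives.Prem)
next
  case (MP \<alpha> \<beta>)
  then obtain M N where "finite M" "finite N"
    "\<forall>\<theta>. avoids \<theta> M \<and> (\<forall>c\<in>cn \<Theta>. \<theta> c \<in> Ter \<Theta>') \<longrightarrow> \<Theta>', fcs \<theta> ` \<Gamma> \<turnstile>QmbC fcs \<theta> \<alpha>"
    "\<forall>\<theta>. avoids \<theta> N \<and> (\<forall>c\<in>cn \<Theta>. \<theta> c \<in> Ter \<Theta>') \<longrightarrow> \<Theta>', fcs \<theta> ` \<Gamma> \<turnstile>QmbC fcs \<theta> (\<alpha> \<^bold>\<longrightarrow> \<beta>)"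
    by blast
  then show ?case by (intro exI[of _ "M \<union> N"]) (auto intro: derives.MP)
next
  case (ExIn \<phi> \<psi> x)
  then obtain N where N: "finite N"
    "\<And>\<theta>. avoids \<theta> N \<Longrightarrow> \<forall>c\<in>cn \<Theta>. \<theta> c \<in> Ter \<Theta>' \<Longrightarrow> \<Theta>', fcs \<theta> ` \<Gamma> \<turnstile>QmbC fcs \<theta> (\<phi> \<^bold>\<longrightarrow> \<psi>)"
    by blast
  have "\<Theta>', fcs \<theta> ` \<Gamma> \<turnstile>QmbC fcs \<theta> (Exists x \<phi> \<^bold>\<longrightarrow> \<psi>)"
    if "avoids \<theta> N" "avoids \<theta> {x}" "\<forall>c\<in>cn \<Theta>. \<theta> c \<in> Ter \<Theta>'" for \<theta>
    using N(2)[OF that(1,3)] FV_fcs_iff[OF that(2), of x \<psi>] ExIn.hyps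
    by (auto intro: derives.ExIn)
  then show ?case using N(1) by (intro exI[of _ "N \<union> {x}"]) (simp del: Un_insert_right)
next
  case (AllIn \<phi> \<psi> x)
  then obtain N where N: "finite N"
    "\<And>\<theta>. avoids \<theta> N \<Longrightarrow> \<forall>c\<in>cn \<Theta>. \<theta> c \<in> Ter \<Theta>' \<Longrightarrow> \<Theta>', fcs \<theta> ` \<Gamma> \<turnstile>QmbC fcs \<theta> (\<phi> \<^bold>\<longrightarrow> \<psi>)"
    by blast
  have "\<Theta>', fcs \<theta> ` \<Gamma> \<turnstile>QmbC fcs \<theta> (\<phi> \<^bold>\<longrightarrow> Forall x \<psi>)"
    if "avoids \<theta> N" "avoids \<theta> {x}" "\<forall>c\<in>cn \<Theta>. \<theta> c \<in> Ter \<Theta>'" for \<theta>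
    using N(2)[OF that(1,3)] FV_fcs_iff[OF that(2), of x \<phi>] AllIn.hyps
    by (auto intro: derives.AllIn)
  then show ?case using N(1) by (intro exI[of _ "N \<union> {x}"]) (simp del: Un_insert_right)
qed

section \<open>Soundness\<close>

lemma tcs_map_trm: "map_trm g (\<lambda>f. f) t = tcs (\<lambda>c. Cst (g c)) t"
  by (induction t) auto

lemma embed_fcs: "embed \<phi> = fcs (\<lambda>c. Cst (Inl c)) \<phi>"
  unfolding embed_def by (induction \<phi>) (auto simp: tcs_map_trm)

lemma embed_simps [simp]:
  "embed (Unary h \<phi>) = Unary h (embed \<phi>)"
  "embed (Binary g \<phi> \<psi>) = Binary g (embed \<phi>) (embed \<psi>)"
  "embed (Quant Q x \<phi>) = Quant Q x (embed \<phi>)"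
  by (simp_all add: embed_fcs)

lemma FV_embed [simp]: "FV (embed \<phi>) = FV \<phi>"
  by (simp add: embed_fcs FV_fcs_closed)

lemma inst_simps [simp]:
  "inst \<mu> (Pred P ts) = Pred P (map (tsub (\<lambda>x. name (\<mu> x))) ts)"
  "inst \<mu> (Unary h \<phi>) = Unary h (inst \<mu> \<phi>)"
  "inst \<mu> (Binary g \<phi> \<psi>) = Binary g (inst \<mu> \<phi>) (inst \<mu> \<psi>)"
  by (simp_all add: inst_def)

lemma inst_Quant: "inst \<mu> (Quant Q x \<phi>) = Quant Q x (fsub ((\<lambda>x. name (\<mu> x))(x := Var x)) \<phi>)"
  by (simp add: inst_def)

lemma inst_upd: "x \<notin> FV \<phi> \<Longrightarrow> inst (\<mu>(x := a)) \<phi> = inst \<mu> \<phi>"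
  unfolding inst_def by (rule fsub_cong) auto

lemma FV_inst [simp]: "FV (inst \<mu> \<phi>) = {}"
  unfolding inst_def by (subst FV_fsub) (auto simp: ground_def)

lemma val_tsub: "val \<AA> \<mu> (tsub \<sigma> t) = val \<AA> (\<lambda>x. val \<AA> \<mu> (\<sigma> x)) t"
proof (induction t)
  case (Fun f ts)
  then have "map (val \<AA> \<mu> \<circ> tsub \<sigma>) ts = map (val \<AA> (\<lambda>x. val \<AA> \<mu> (\<sigma> x))) ts" by auto
  then show ?case by (simp del: map_eq_conv)
qed auto

lemma val_cong: "(\<And>x. x \<in> vars t \<Longrightarrow> \<mu> x = \<nu> x) \<Longrightarrow> val \<AA> \<mu> t = val \<AA> \<nu> t"
proof (induction t)
  case (Fun f ts)
  then have "map (val \<AA> \<mu>) ts = map (val \<AA> \<nu>) ts" by auto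
  then show ?case by (simp del: map_eq_conv)
qed auto

lemma ic_diag_str_Inr [simp]: "ic (diag_str \<AA>) (Inr a) = a"
  by (simp add: diag_str_def)

lemma derives_For: "\<Theta>, \<Gamma> \<turnstile>QmbC \<phi> \<Longrightarrow> \<phi> \<in> For \<Theta>"
  by (induction rule: derives.induct) auto

section \<open>Truth under an assignment, for one fixed valuation\<close>

locale qmbc_val =
  fixes \<Theta> :: "('c, 'f, 'p) sig" and \<AA> :: "('c, 'f, 'p, 'u) str" and v
  assumes str: "structure \<Theta> \<AA>" and val: "valuation \<Theta> \<AA> v"
begin

abbreviation "U \<equiv> dm \<AA>"
abbreviation "T \<equiv> Ter (diag_sig \<Theta> U)"
abbreviation "F \<equiv> For (diag_sig \<Theta> U)"
abbreviation "S \<equiv> Sen (diag_sig \<Theta> U)"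

lemma name_T: "a \<in> U \<Longrightarrow> name a \<in> T"
  by (auto simp: diag_sig_def)

lemma val_U: "t \<in> T \<Longrightarrow> assignment \<AA> \<mu> \<Longrightarrow> val (diag_str \<AA>) \<mu> t \<in> U"
proof (induction rule: Ter.induct)
  case (3 ts f)
  then have "set (map (val (diag_str \<AA>) \<mu>) ts) \<subseteq> U" by auto
  moreover have "f \<in> fn \<Theta> (length ts)" "length ts \<ge> 1"
    using 3 by (auto simp: diag_sig_def Suc_le_eq)
  ultimately have "ifn \<AA> f (map (val (diag_str \<AA>) \<mu>) ts) \<in> U"
    using str unfolding structure_def by (metis length_map)
  then show ?case by (simp add: diag_str_def)
qed (use str in \<open>auto simp: assignment_def diag_str_def diag_sig_def structure_def\<close>)

lemma inst_S: "\<phi> \<in> F \<Longrightarrow> assignment \<AA> \<mu> \<Longrightarrow> inst \<mu> \<phi> \<in> S"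
  using fsub_For[of \<phi> _ "\<lambda>x. name (\<mu> x)"] name_T
  by (simp add: Sen_def assignment_def del: Ter_simps) (simp add: inst_def)

lemmas v_clauses = val[unfolded valuation_def Let_def]
lemmas v_clauses2 = v_clauses[THEN conjunct2]
lemmas v_clauses3 = v_clauses2[THEN conjunct2]
lemmas v_clauses4 = v_clauses3[THEN conjunct2]
lemmas v_clauses5 = v_clauses4[THEN conjunct2]
lemmas v_clauses6 = v_clauses5[THEN conjunct2]
lemmas v_clauses7 = v_clauses6[THEN conjunct2]

lemma v_M5: "\<phi> \<in> S \<Longrightarrow> v \<phi> \<in> M5"
  using v_clauses[THEN conjunct1] by blast

lemma v_Pred: "Pred P ts \<in> S \<Longrightarrow> assignment \<AA> \<mu> \<Longrightarrow>
    v (Pred P ts) = ipr \<AA> P (map (val (diag_str \<AA>) \<mu>) ts)"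
  using v_clauses2[THEN conjunct1] by blast

lemma v_Unary: "\<phi> \<in> S \<Longrightarrow> v (Unary h \<phi>) \<in> M5_un h (v \<phi>)"
  using v_clauses3[THEN conjunct1] by blast

lemma v_Binary: "\<phi> \<in> S \<Longrightarrow> \<psi> \<in> S \<Longrightarrow> p1 (v (Binary h \<phi> \<psi>)) = bool_op h (p1 (v \<phi>)) (p1 (v \<psi>))"
  using v_clauses4[THEN conjunct1] unfolding M5_bin_def by blast

lemma v_Forall: "Forall x \<phi> \<in> S \<Longrightarrow> p1 (v (Forall x \<phi>)) = (\<forall>a\<in>U. p1 (v (\<phi>\<langle>x := name a\<rangle>)))"
  using v_clauses5[THEN conjunct1] by blast

lemma v_Exists: "Exists x \<phi> \<in> S \<Longrightarrow> p1 (v (Exists x \<phi>)) = (\<exists>a\<in>U. p1 (v (\<phi>\<langle>x := name a\<rangle>)))"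
  using v_clauses6[THEN conjunct1] by blast

lemma v_variant: "\<phi> \<in> S \<Longrightarrow> \<psi> \<in> S \<Longrightarrow> variant \<phi> \<psi> \<Longrightarrow> v \<phi> = v \<psi>"
  using v_clauses7[THEN conjunct2] by blast

lemma v_subst_Unary:
  assumes "t \<in> T" "assignment \<AA> \<mu>" "b = val (diag_str \<AA>) \<mu> t" "\<phi> \<in> F" "free_for t z \<phi>"
    "v (inst \<mu> (\<phi>\<langle>z := t\<rangle>)) = v (inst \<mu> (\<phi>\<langle>z := name b\<rangle>))"
  shows "v (inst \<mu> ((Unary h \<phi>)\<langle>z := t\<rangle>)) = v (inst \<mu> ((Unary h \<phi>)\<langle>z := name b\<rangle>))"
  using v_clauses7[THEN conjunct1, rule_format, OF assms(1) conjI[OF assms(2,3)],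
      THEN conjunct1] assms(4-)
  by simp

lemma v_subst_Binary:
  assumes "t \<in> T" "assignment \<AA> \<mu>" "b = val (diag_str \<AA>) \<mu> t"
    "\<phi> \<in> F" "free_for t z \<phi>" "\<psi> \<in> F" "free_for t z \<psi>"
    "v (inst \<mu> (\<phi>\<langle>z := t\<rangle>)) = v (inst \<mu> (\<phi>\<langle>z := name b\<rangle>))"
    "v (inst \<mu> (\<psi>\<langle>z := t\<rangle>)) = v (inst \<mu> (\<psi>\<langle>z := name b\<rangle>))"
  shows "v (inst \<mu> ((Binary h \<phi> \<psi>)\<langle>z := t\<rangle>)) = v (inst \<mu> ((Binary h \<phi> \<psi>)\<langle>z := name b\<rangle>))"
  using v_clauses7[THEN conjunct1, rule_format, OF assms(1) conjI[OF assms(2,3)],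
      THEN conjunct2, THEN conjunct1] assms(4-)
  by simp

lemma v_subst_Quant:
  assumes "t \<in> T" "assignment \<AA> \<mu>" "b = val (diag_str \<AA>) \<mu> t"
    "\<phi> \<in> F" "free_for t z \<phi>" "x \<noteq> z" "x \<notin> vars t"
    "\<forall>a\<in>U. v (inst (\<mu>(x := a)) (\<phi>\<langle>z := t\<rangle>)) = v (inst (\<mu>(x := a)) (\<phi>\<langle>z := name b\<rangle>))"
  shows "v (inst \<mu> ((Quant Q x \<phi>)\<langle>z := t\<rangle>)) = v (inst \<mu> ((Quant Q x \<phi>)\<langle>z := name b\<rangle>))"
  using v_clauses7[THEN conjunct1, rule_format, OF assms(1) conjI[OF assms(2,3)],
      THEN conjunct2, THEN conjunct2] assms(4-)
  by simp

text \<open>Only the atomic case is computed; every other case is an appeal to (vi). Clause (vi.3)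
  needs \<open>x \<noteq> z\<close> and \<open>x\<close> outside \<open>t\<close>: if
  \<open>z\<close> is not free in the quantified formula both substitutions are void, and otherwise
  freeness supplies both conditions.\<close>

lemma v_subst:
  "\<phi> \<in> F \<Longrightarrow> t \<in> T \<Longrightarrow> free_for t z \<phi> \<Longrightarrow> assignment \<AA> \<mu> \<Longrightarrow>
    v (inst \<mu> (\<phi>\<langle>z := t\<rangle>)) = v (inst \<mu> (\<phi>\<langle>z := name (val (diag_str \<AA>) \<mu> t)\<rangle>))"
proof (induction \<phi> arbitrary: \<mu>)
  case (Pred P ts)
  let ?b = "val (diag_str \<AA>) \<mu> t"
  have "inst \<mu> ((Pred P ts)\<langle>z := t\<rangle>) \<in> S" "inst \<mu> ((Pred P ts)\<langle>z := name ?b\<rangle>) \<in> S"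
    using Pred val_U by (auto intro!: inst_S subst_For simp: name_T simp del: inst_simps Ter_simps)
  then show ?case
    using Pred.prems(4)
    by (simp add: subst_def v_Pred val_tsub o_def)
      (auto simp: val_tsub o_def intro!: arg_cong[where f = "ipr \<AA> P"] val_cong)
next
  case (Unary h \<phi>)
  show ?case
    by (rule v_subst_Unary[OF Unary.prems(2,4) HOL.refl]) (use Unary in auto)
next
  case (Binary h \<phi> \<psi>)
  show ?case
    by (rule v_subst_Binary[OF Binary.prems(2,4) HOL.refl]) (use Binary in auto)
next
  case (Quant Q x \<phi>)
  show ?case
  proof (cases "x = z \<or> z \<notin> FV \<phi>")
    case True
    then have "z \<notin> FV (Quant Q x \<phi>)" by auto
    then show ?thesis by (simp only: subst_not_free not_False_eq_True)
  next
    case False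
    then have x: "x \<notin> vars t" "free_for t z \<phi>" using Quant.prems by auto
    have "v (inst (\<mu>(x := a)) (\<phi>\<langle>z := t\<rangle>)) =
        v (inst (\<mu>(x := a)) (\<phi>\<langle>z := name (val (diag_str \<AA>) \<mu> t)\<rangle>))" if "a \<in> U" for a
    proof -
      \<comment> \<open>The name in the goal is fixed by \<mu>, whereas the induction hypothesis
        speaks of the value of \<open>t\<close> under \<open>\<mu>(x := a)\<close>.\<close>
      have "val (diag_str \<AA>) (\<mu>(x := a)) t = val (diag_str \<AA>) \<mu> t"
        using x by (intro val_cong) auto
      moreover have "assignment \<AA> (\<mu>(x := a))"
        using that Quant.prems(4) by (auto simp: assignment_def)
      ultimately show ?thesis
        using Quant.IH[of "\<mu>(x := a)"] Quant.prems x by (simp del: fun_upd_apply)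
    qed
    then show ?thesis
      by (intro v_subst_Quant[OF Quant.prems(2,4) HOL.refl]) (use Quant.prems x False in auto)
  qed
qed

abbreviation holds :: "(nat \<Rightarrow> 'u) \<Rightarrow> ('c + 'u, 'f, 'p) fm \<Rightarrow> bool" where
  "holds \<mu> \<phi> \<equiv> p1 (v (inst \<mu> \<phi>))"

lemma holds_Binary [simp]:
  "\<phi> \<in> F \<Longrightarrow> \<psi> \<in> F \<Longrightarrow> assignment \<AA> \<mu> \<Longrightarrow>
    holds \<mu> (Binary h \<phi> \<psi>) = bool_op h (holds \<mu> \<phi>) (holds \<mu> \<psi>)"
  by (simp add: v_Binary inst_S)

lemma holds_Neg: "\<phi> \<in> F \<Longrightarrow> assignment \<AA> \<mu> \<Longrightarrow> holds \<mu> (Neg \<phi>) = p2 (v (inst \<mu> \<phi>))"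
  using v_Unary[OF inst_S, of \<phi> \<mu> UNeg] by simp

lemma holds_Circ: "\<phi> \<in> F \<Longrightarrow> assignment \<AA> \<mu> \<Longrightarrow> holds \<mu> (Circ \<phi>) = p3 (v (inst \<mu> \<phi>))"
  using v_Unary[OF inst_S, of \<phi> \<mu> UCirc] by simp

lemma inst_Quant_subst:
  "(fsub ((\<lambda>x. name (\<mu> x))(x := Var x)) \<phi>)\<langle>x := name a\<rangle> = inst (\<mu>(x := a)) \<phi>"
  by (subst subst_fsub_upd) (auto simp: inst_def intro: fsub_cong)

lemma holds_Forall [simp]:
  assumes "\<phi> \<in> F" "assignment \<AA> \<mu>"
  shows "holds \<mu> (Forall x \<phi>) = (\<forall>a\<in>U. holds (\<mu>(x := a)) \<phi>)"
  using v_Forall[of x "fsub ((\<lambda>x. name (\<mu> x))(x := Var x)) \<phi>"] inst_S[of "Forall x \<phi>" \<mu>] assms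
  by (simp add: inst_Quant inst_Quant_subst)

lemma holds_Exists [simp]:
  assumes "\<phi> \<in> F" "assignment \<AA> \<mu>"
  shows "holds \<mu> (Exists x \<phi>) = (\<exists>a\<in>U. holds (\<mu>(x := a)) \<phi>)"
  using v_Exists[of x "fsub ((\<lambda>x. name (\<mu> x))(x := Var x)) \<phi>"] inst_S[of "Exists x \<phi>" \<mu>] assms
  by (simp add: inst_Quant inst_Quant_subst)

text \<open>A vacuous substitution may use a term outside the language; it is then replaced by the
  trivial one.\<close>

lemma holds_subst:
  assumes "\<phi> \<in> F" "\<phi>\<langle>x := t\<rangle> \<in> F" "free_for t x \<phi>" "assignment \<AA> \<mu>"
  obtains a where "a \<in> U" "v (inst \<mu> (\<phi>\<langle>x := t\<rangle>)) = v (inst (\<mu>(x := a)) \<phi>)"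
proof -
  define t' where "t' = (if x \<in> FV \<phi> then t else Var x)"
  have eq: "\<phi>\<langle>x := t'\<rangle> = \<phi>\<langle>x := t\<rangle>" by (simp add: t'_def subst_not_free)
  have "free_for t' x \<phi>" using assms(3) by (simp add: t'_def free_for_self)
  moreover have "t' \<in> T"
    using fsub_For_D[of "Var(x := t)" \<phi> "diag_sig \<Theta> U" x] assms(2)
    by (simp add: t'_def subst_def)
  moreover define b where "b = val (diag_str \<AA>) \<mu> t'"
  ultimately have "v (inst \<mu> (\<phi>\<langle>x := t\<rangle>)) = v (inst \<mu> (\<phi>\<langle>x := name b\<rangle>))"
    using v_subst[of \<phi> t' x \<mu>] assms eq by simp
  also have "inst \<mu> (\<phi>\<langle>x := name b\<rangle>) = inst (\<mu>(x := b)) \<phi>"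
    unfolding inst_def by (subst fsub_subst) (auto simp: free_for_closed intro: fsub_cong)
  finally show thesis
    using that val_U[OF \<open>t' \<in> T\<close> assms(4)] by (auto simp: b_def)
qed

text \<open>A10 and A11 correspond to the two conditions that cut out \<open>M5\<close>; Ax14 is
  (vii) after the variants are turned into sentences; Ax12 and Ax13 need the substitution lemma; the
  rest is Boolean.\<close>

lemma holds_axiom:
  assumes "axiom \<phi>" "\<phi> \<in> F" "assignment \<AA> \<mu>"
  shows "holds \<mu> \<phi>"
proof -
  have M5: "v (inst \<mu> \<psi>) \<in> M5" if "\<psi> \<in> F" for \<psi>
    using that assms(3) by (simp add: v_M5 inst_S)
  show ?thesis
    using assms(1)
  proof cases
    case (A10 \<alpha>)
    then show ?thesis
      using assms(2,3) M5[of \<alpha>] by (simp add: holds_Neg M5_def del: inst_simps)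
  next
    case (A11 \<alpha> \<beta>)
    then show ?thesis
      using assms(2,3) M5[of \<alpha>] by (auto simp: holds_Neg holds_Circ M5_def simp del: inst_simps)
  next
    case (Ax12 t x \<psi>)
    then show ?thesis
      using assms(2,3) holds_subst[of \<psi> x t \<mu>]
      by (simp del: inst_simps) metis
  next
    case (Ax13 t x \<psi>)
    then show ?thesis
      using assms(2,3) holds_subst[of \<psi> x t \<mu>]
      by (simp del: inst_simps) metis
  next
    case (Ax14 \<alpha> \<beta>)
    then have "v (inst \<mu> \<alpha>) = v (inst \<mu> \<beta>)"
      using assms(2,3) unfolding inst_def
      by (intro v_variant variant_fsub ground_closed) (auto simp: inst_S inst_def[symmetric])
    then show ?thesis using Ax14 assms(2,3) by (simp del: inst_simps)
  qed (use assms(2,3) in \<open>auto simp del: inst_simps\<close>)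
qed

lemma embed_F: "\<phi> \<in> For \<Theta> \<Longrightarrow> embed \<phi> \<in> F"
  unfolding embed_fcs by (erule fcs_For) (auto simp: diag_sig_def)

lemma axiom_embed: "axiom \<phi> \<Longrightarrow> axiom (embed \<phi> :: ('c + 'u, 'f, 'p) fm)"
  unfolding embed_fcs using axiom_fcs by (metis avoids_closed vars.simps(2))

text \<open>The induction ranges over all assignments, since the quantifier rules use the induction
  hypothesis at \<open>\<mu>(x := a)\<close>. This is why the premises have to hold under every
  assignment.\<close>

lemma holds_derives:
  "\<Theta>, \<Gamma> \<turnstile>QmbC \<phi> \<Longrightarrow> (\<And>\<gamma> \<mu>. \<gamma> \<in> \<Gamma> \<Longrightarrow> assignment \<AA> \<mu> \<Longrightarrow> holds \<mu> (embed \<gamma>)) \<Longrightarrow> assignment \<AA> \<mu>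
    \<Longrightarrow> holds \<mu> (embed \<phi>)"
proof (induction arbitrary: \<mu> rule: derives.induct)
  case (Ax \<phi>)
  then show ?case by (simp add: holds_axiom axiom_embed embed_F)
next
  case (MP \<alpha> \<beta>)
  have "embed \<alpha> \<in> F" "embed \<beta> \<in> F" using derives_For[OF MP.hyps(2)] by (auto intro: embed_F)
  then show ?case using MP by (simp del: inst_simps)
next
  case (ExIn \<phi> \<psi> x)
  have F: "embed \<phi> \<in> F" "embed \<psi> \<in> F" using derives_For[OF ExIn.hyps(1)] by (auto intro: embed_F)
  have "holds \<mu> (embed \<psi>)" if "a \<in> U" "holds (\<mu>(x := a)) (embed \<phi>)" for a
  proof -
    have a: "assignment \<AA> (\<mu>(x := a))" using that ExIn.prems(2) by (simp add: assignment_def)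
    have "holds (\<mu>(x := a)) (embed \<psi>)"
      using ExIn.IH[OF ExIn.prems(1) a] F a that by (simp del: inst_simps fun_upd_apply)
    then show ?thesis using ExIn.hyps by (simp add: inst_upd)
  qed
  then show ?case using F ExIn.prems by (auto simp del: inst_simps)
next
  case (AllIn \<phi> \<psi> x)
  have F: "embed \<phi> \<in> F" "embed \<psi> \<in> F" using derives_For[OF AllIn.hyps(1)] by (auto intro: embed_F)
  have "holds (\<mu>(x := a)) (embed \<psi>)" if "a \<in> U" "holds \<mu> (embed \<phi>)" for a
  proof -
    have a: "assignment \<AA> (\<mu>(x := a))" using that AllIn.prems(2) by (simp add: assignment_def)
    have "holds (\<mu>(x := a)) (embed \<phi>)" using AllIn.hyps that by (simp add: inst_upd)
    then show ?thesis using AllIn.IH[OF AllIn.prems(1) a] F a by (simp del: inst_simps fun_upd_apply)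
  qed
  then show ?case using F AllIn.prems by (auto simp del: inst_simps)
qed simp

end

theorem soundness:
  assumes "\<Theta>, \<Gamma> \<turnstile>QmbC \<phi>" "structure \<Theta> \<AA>"
  shows "consequence \<Theta> \<AA> \<Gamma> \<phi>"
  unfolding consequence_def
proof (intro allI impI)
  fix v \<mu>
  assume v: "valuation \<Theta> \<AA> v" and "assignment \<AA> \<mu>"
    and \<Gamma>: "\<forall>\<gamma>\<in>\<Gamma>. \<forall>\<mu>. assignment \<AA> \<mu> \<longrightarrow> v (inst \<mu> (embed \<gamma>)) \<in> D5"
  interpret qmbc_val \<Theta> \<AA> v using assms(2) v by unfold_locales
  have "holds \<mu> (embed \<phi>)"
    using assms(1) by (rule holds_derives) (use \<Gamma> \<open>assignment \<AA> \<mu>\<close> in \<open>auto simp: D5_def\<close>)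
  moreover have "v (inst \<mu> (embed \<phi>)) \<in> M5"
    using \<open>assignment \<AA> \<mu>\<close> derives_For[OF assms(1)] by (simp add: v_M5 inst_S embed_F)
  ultimately show "v (inst \<mu> (embed \<phi>)) \<in> D5" by (simp add: D5_def)
qed

section \<open>Derivations\<close>

lemma derives_mono: "\<Theta>, \<Gamma> \<turnstile>QmbC \<phi> \<Longrightarrow> \<Gamma> \<subseteq> \<Delta> \<Longrightarrow> \<Theta>, \<Delta> \<turnstile>QmbC \<phi>"
  by (induction rule: derives.induct) (auto intro: derives.intros)

lemma derives_compact:
  "\<Theta>, \<Gamma> \<turnstile>QmbC \<phi> \<Longrightarrow> \<exists>\<Gamma>'. finite \<Gamma>' \<and> \<Gamma>' \<subseteq> \<Gamma> \<and> \<Theta>, \<Gamma>' \<turnstile>QmbC \<phi>"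
proof (induction rule: derives.induct)
  case (Ax \<phi>)
  then show ?case by (intro exI[of _ "{}"]) (auto intro: derives.Ax)
next
  case (Prem \<phi>)
  then show ?case by (intro exI[of _ "{\<phi>}"]) (auto intro: derives.Prem)
next
  case (MP \<alpha> \<beta>)
  then obtain A B where "finite A" "A \<subseteq> \<Gamma>" "\<Theta>, A \<turnstile>QmbC \<alpha>" "finite B" "B \<subseteq> \<Gamma>" "\<Theta>, B \<turnstile>QmbC (\<alpha> \<^bold>\<longrightarrow> \<beta>)"
    by blast
  then show ?case
    by (intro exI[of _ "A \<union> B"]) (auto intro: derives.MP derives_mono[of _ A] derives_mono[of _ B])
qed (blast intro: derives.intros)+

section \<open>Positive classical reasoning inside the calculus\<close>

lemma imp_const: "\<Theta>, \<Gamma> \<turnstile>QmbC \<beta> \<Longrightarrow> \<alpha> \<in> For \<Theta> \<Longrightarrow> \<Theta>, \<Gamma> \<turnstile>QmbC \<alpha> \<^bold>\<longrightarrow> \<beta>"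
  by (rule MP[OF _ Ax[OF _ A1]]) (auto dest: derives_For)

lemma imp_mp:
  assumes "\<Theta>, \<Gamma> \<turnstile>QmbC \<delta> \<^bold>\<longrightarrow> \<beta> \<^bold>\<longrightarrow> \<gamma>" "\<Theta>, \<Gamma> \<turnstile>QmbC \<delta> \<^bold>\<longrightarrow> \<beta>"
  shows "\<Theta>, \<Gamma> \<turnstile>QmbC \<delta> \<^bold>\<longrightarrow> \<gamma>"
  using derives_For[OF assms(1)] by (intro MP[OF assms(2) MP[OF assms(1) Ax[OF _ A2]]]) simp

lemma imp_trans:
  assumes "\<Theta>, \<Gamma> \<turnstile>QmbC \<alpha> \<^bold>\<longrightarrow> \<beta>" "\<Theta>, \<Gamma> \<turnstile>QmbC \<beta> \<^bold>\<longrightarrow> \<gamma>"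
  shows "\<Theta>, \<Gamma> \<turnstile>QmbC \<alpha> \<^bold>\<longrightarrow> \<gamma>"
  using derives_For[OF assms(1)] by (intro imp_mp[OF imp_const[OF assms(2)] assms(1)]) simp

lemma imp_refl:
  assumes "\<alpha> \<in> For \<Theta>"
  shows "\<Theta>, \<Gamma> \<turnstile>QmbC \<alpha> \<^bold>\<longrightarrow> \<alpha>"
  by (rule imp_mp[of _ _ _ "\<alpha> \<^bold>\<longrightarrow> \<alpha>"]; rule Ax[OF _ A1]) (use assms in simp_all)

lemma imp_swap:
  assumes "\<Theta>, \<Gamma> \<turnstile>QmbC \<alpha> \<^bold>\<longrightarrow> \<beta> \<^bold>\<longrightarrow> \<gamma>"
  shows "\<Theta>, \<Gamma> \<turnstile>QmbC \<beta> \<^bold>\<longrightarrow> \<alpha> \<^bold>\<longrightarrow> \<gamma>"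
  using derives_For[OF assms]
  by (intro imp_trans[OF Ax[OF _ A1] MP[OF assms Ax[OF _ A2]]]) simp_all

lemma imp_uncurry:
  assumes "\<Theta>, \<Gamma> \<turnstile>QmbC \<alpha> \<^bold>\<longrightarrow> \<beta> \<^bold>\<longrightarrow> \<gamma>"
  shows "\<Theta>, \<Gamma> \<turnstile>QmbC (\<alpha> \<^bold>\<and> \<beta>) \<^bold>\<longrightarrow> \<gamma>"
  using derives_For[OF assms]
  by (intro imp_mp[OF imp_trans[OF Ax[OF _ A4] assms] Ax[OF _ A5]]) simp_all

lemma imp_curry:
  assumes "\<Theta>, \<Gamma> \<turnstile>QmbC (\<alpha> \<^bold>\<and> \<beta>) \<^bold>\<longrightarrow> \<gamma>"
  shows "\<Theta>, \<Gamma> \<turnstile>QmbC \<alpha> \<^bold>\<longrightarrow> \<beta> \<^bold>\<longrightarrow> \<gamma>"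
  using derives_For[OF assms]
  by (intro imp_trans[OF Ax[OF _ A3] MP[OF imp_const[OF assms] Ax[OF _ A2]]]) simp_all

lemma disj_cases:
  assumes "\<Theta>, \<Gamma> \<turnstile>QmbC \<alpha> \<^bold>\<or> \<beta>" "\<Theta>, \<Gamma> \<turnstile>QmbC \<alpha> \<^bold>\<longrightarrow> \<gamma>" "\<Theta>, \<Gamma> \<turnstile>QmbC \<beta> \<^bold>\<longrightarrow> \<gamma>"
  shows "\<Theta>, \<Gamma> \<turnstile>QmbC \<gamma>"
  using derives_For[OF assms(1)] derives_For[OF assms(2)]
  by (intro MP[OF assms(1) MP[OF assms(3) MP[OF assms(2) Ax[OF _ A8]]]]) simp

lemma variant_derives:
  "\<Theta>, \<Gamma> \<turnstile>QmbC \<alpha> \<Longrightarrow> variant \<alpha> \<beta> \<Longrightarrow> \<beta> \<in> For \<Theta> \<Longrightarrow> \<Theta>, \<Gamma> \<turnstile>QmbC \<beta>"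
  by (frule derives_For, rule MP[OF _ Ax[OF _ Ax14]], assumption) auto

text \<open>A sentence has no free variable that could violate a side condition. For
  \<open>ExIn\<close> the assumption is swapped behind the quantified formula, for
  \<open>AllIn\<close> it is absorbed into the antecedent by a conjunction.\<close>

theorem deduction:
  assumes "\<Theta>, insert \<alpha> \<Gamma> \<turnstile>QmbC \<phi>" and \<alpha>: "\<alpha> \<in> Sen \<Theta>"
  shows "\<Theta>, \<Gamma> \<turnstile>QmbC \<alpha> \<^bold>\<longrightarrow> \<phi>"
  using assms(1)
proof (induction rule: derives.induct)
  case (Ax \<phi>)
  then show ?case using \<alpha> by (intro imp_const derives.Ax) (auto simp: Sen_def)
next
  case (Prem \<phi>)
  then show ?case using \<alpha> by (auto simp: Sen_def intro: imp_refl imp_const derives.Prem)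
next
  case (MP \<beta> \<gamma>)
  then show ?case by (blast intro: imp_mp)
next
  case (ExIn \<phi> \<psi> x)
  then show ?case using \<alpha> by (intro imp_swap[OF derives.ExIn[OF imp_swap]]) (auto simp: Sen_def)
next
  case (AllIn \<phi> \<psi> x)
  then show ?case using \<alpha>
    by (intro imp_curry[OF derives.AllIn[OF imp_uncurry]]) (auto simp: Sen_def)
qed

lemma generalization:
  assumes "\<Theta>, \<Gamma> \<turnstile>QmbC \<phi>"
  shows "\<Theta>, \<Gamma> \<turnstile>QmbC Forall x \<phi>"
proof -
  have "\<phi> \<in> For \<Theta>" using assms by (rule derives_For)
  \<comment> \<open>The rule for \<forall> needs an antecedent in which \<open>x\<close> is not
    free; any such theorem serves, and this one is at hand.\<close>
  then have "\<Theta>, \<Gamma> \<turnstile>QmbC Forall x \<phi> \<^bold>\<longrightarrow> Forall x \<phi>" by (simp add: imp_refl)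
  moreover have "\<Theta>, \<Gamma> \<turnstile>QmbC (Forall x \<phi> \<^bold>\<longrightarrow> Forall x \<phi>) \<^bold>\<longrightarrow> Forall x \<phi>"
    using assms \<open>\<phi> \<in> For \<Theta>\<close> by (intro AllIn imp_const) auto
  ultimately show ?thesis by (rule MP)
qed

lemma Forall_E:
  "\<Theta>, \<Gamma> \<turnstile>QmbC Forall x \<phi> \<Longrightarrow> t \<in> Ter \<Theta> \<Longrightarrow> free_for t x \<phi> \<Longrightarrow> \<Theta>, \<Gamma> \<turnstile>QmbC \<phi>\<langle>x := t\<rangle>"
  by (frule derives_For, rule MP[OF _ Ax[OF _ Ax13]], assumption) (auto intro: subst_For)

text \<open>The calculus instantiates one variable at a time. Closed terms contain nothing for later
  steps to replace, so finitely many single steps add up to the simultaneous substitution.\<close>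

lemma derives_fsub:
  assumes "\<Theta>, \<Gamma> \<turnstile>QmbC \<phi>" and \<sigma>: "\<And>x. \<sigma> x \<in> Ter \<Theta>" "\<And>x. vars (\<sigma> x) = {}"
  shows "\<Theta>, \<Gamma> \<turnstile>QmbC fsub \<sigma> \<phi>"
proof -
  have "\<Theta>, \<Gamma> \<turnstile>QmbC fsub (\<lambda>x. if x \<in> X then \<sigma> x else Var x) \<phi>" if "finite X" for X
    using that
  proof induction
    case empty
    then show ?case using assms(1) by simp
  next
    case (insert x X)
    let ?\<tau> = "\<lambda>x. if x \<in> X then \<sigma> x else Var x"
    have "\<Theta>, \<Gamma> \<turnstile>QmbC (fsub ?\<tau> \<phi>)\<langle>x := \<sigma> x\<rangle>"
      by (intro Forall_E generalization insert.IH \<sigma> free_for_closed)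
    moreover have "ground ?\<tau>" using \<sigma> by (simp add: ground_def)
    then have "(fsub ?\<tau> \<phi>)\<langle>x := \<sigma> x\<rangle> = fsub (\<lambda>y. if y \<in> insert x X then \<sigma> y else Var y) \<phi>"
      unfolding subst_def using \<sigma> by (auto simp: fsub_fsub tsub_closed intro!: fsub_cong)
    ultimately show ?case by simp
  qed
  from this[of "FV \<phi>"] have "\<Theta>, \<Gamma> \<turnstile>QmbC fsub (\<lambda>x. if x \<in> FV \<phi> then \<sigma> x else Var x) \<phi>" by simp
  also have "fsub (\<lambda>x. if x \<in> FV \<phi> then \<sigma> x else Var x) \<phi> = fsub \<sigma> \<phi>" by (rule fsub_cong) simp
  finally show ?thesis .
qed

lemma derives_foldr_ForallD: "\<Theta>, \<Gamma> \<turnstile>QmbC foldr Forall xs \<phi> \<Longrightarrow> \<Theta>, \<Gamma> \<turnstile>QmbC \<phi>"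
proof (induction xs)
  case (Cons x xs)
  then have "\<Theta>, \<Gamma> \<turnstile>QmbC (foldr Forall xs \<phi>)\<langle>x := Var x\<rangle>"
    by (intro Forall_E free_for_self) auto
  then show ?case using Cons.IH by simp
qed simp

lemma foldr_Forall_For: "foldr Forall xs \<phi> \<in> For \<Theta> \<longleftrightarrow> \<phi> \<in> For \<Theta>"
  by (induction xs) auto

lemma FV_foldr_Forall: "FV (foldr Forall xs \<phi>) = FV \<phi> - set xs"
  by (induction xs) auto

section \<open>Witnessing constants\<close>

lemma set1_tsub: "set1_trm (tsub \<sigma> t) \<subseteq> set1_trm t \<union> (\<Union>x. set1_trm (\<sigma> x))"
  by (induction t) fastforce+

lemma set1_fsub: "set1_fm (fsub \<sigma> \<phi>) \<subseteq> set1_fm \<phi> \<union> (\<Union>x. set1_trm (\<sigma> x))"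
proof (induction \<phi> arbitrary: \<sigma>)
  case (Pred P ts)
  then show ?case using set1_tsub by fastforce
next
  case (Quant Q x \<phi>)
  have "(\<Union>y. set1_trm ((\<sigma>(x := Var x)) y)) \<subseteq> (\<Union>y. set1_trm (\<sigma> y))" by (auto split: if_splits)
  with Quant[of "\<sigma>(x := Var x)"]
  have "set1_fm (fsub (\<sigma>(x := Var x)) \<phi>) \<subseteq> set1_fm \<phi> \<union> (\<Union>y. set1_trm (\<sigma> y))" by blast
  then show ?case by simp
qed auto

lemma set1_subst: "set1_fm (\<phi>\<langle>x := t\<rangle>) \<subseteq> set1_fm \<phi> \<union> set1_trm t"
  using set1_fsub[of "Var(x := t)" \<phi>] by (auto simp: subst_def split: if_splits)

lemma free_for_not_BV: "y \<notin> BV \<phi> \<Longrightarrow> free_for (Var y) x \<phi>"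
  by (induction \<phi>) auto

lemma fcs_upd: "c \<notin> set1_fm \<phi> \<Longrightarrow> fcs (Cst(c := t)) \<phi> = \<phi>"
  by (subst fcs_cong[where \<eta> = Cst]) auto

text \<open>A constant absent from the premises behaves like a variable. The set \<open>M\<close>
  allows the caller to keep that variable away from its own formulas.\<close>

lemma constant_generalization:
  assumes "\<Theta>, \<Gamma> \<turnstile>QmbC \<phi>" "\<And>\<gamma>. \<gamma> \<in> \<Gamma> \<Longrightarrow> c \<notin> set1_fm \<gamma>" "finite M"
  obtains y where "y \<notin> M" "\<Theta>, \<Gamma> \<turnstile>QmbC fcs (Cst(c := Var y)) \<phi>"
proof -
  obtain N where N: "finite N" "\<And>\<theta>. avoids \<theta> N \<Longrightarrow> \<forall>c\<in>cn \<Theta>. \<theta> c \<in> Ter \<Theta>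
      \<Longrightarrow> \<Theta>, fcs \<theta> ` \<Gamma> \<turnstile>QmbC fcs \<theta> \<phi>"
    using derives_fcs[OF assms(1), of \<Theta>] by blast
  obtain y where y: "y \<notin> M \<union> N"
    using N(1) assms(3) ex_new_if_finite[of "M \<union> N"] by auto
  have "\<Theta>, fcs (Cst(c := Var y)) ` \<Gamma> \<turnstile>QmbC fcs (Cst(c := Var y)) \<phi>"
    using y by (intro N(2)) (auto simp: avoids_def)
  moreover have "fcs (Cst(c := Var y)) ` \<Gamma> = \<Gamma>" using assms(2) by (simp add: fcs_upd)
  ultimately show thesis using that[of y] y by simp
qed

lemma fcs_witness:
  "c \<notin> set1_fm \<phi> \<Longrightarrow> y \<noteq> x \<Longrightarrow> fcs (Cst(c := Var y)) (\<phi>\<langle>x := Cst c\<rangle>) = \<phi>\<langle>x := Var y\<rangle>"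
  by (subst fcs_subst) (auto simp: fcs_upd)

text \<open>For a universal formula the constant names a counterexample if there is one.\<close>

definition witness_ax :: "quant \<Rightarrow> nat \<Rightarrow> ('c, 'f, 'p) fm \<Rightarrow> 'c \<Rightarrow> ('c, 'f, 'p) fm" where
  "witness_ax Q x \<psi> c = (case Q of
      QEx \<Rightarrow> Exists x \<psi> \<^bold>\<longrightarrow> \<psi>\<langle>x := Cst c\<rangle>
    | QAll \<Rightarrow> \<psi>\<langle>x := Cst c\<rangle> \<^bold>\<longrightarrow> Forall x \<psi>)"

text \<open>\<open>QmbC\<close> contains positive classical logic by (A9), which is all that is needed to see that a
  witnessing axiom for a new constant is conservative.\<close>

lemma witness_ax_conservative:
  assumes d: "\<Theta>, insert (witness_ax Q x \<psi> c) \<Gamma> \<turnstile>QmbC \<chi>"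
    and \<psi>: "Quant Q x \<psi> \<in> Sen \<Theta>" and \<chi>: "\<chi> \<in> Sen \<Theta>" and c: "c \<in> cn \<Theta>"
    and fresh: "c \<notin> set1_fm \<psi>" "c \<notin> set1_fm \<chi>" "\<And>\<gamma>. \<gamma> \<in> \<Gamma> \<Longrightarrow> c \<notin> set1_fm \<gamma>"
  shows "\<Theta>, \<Gamma> \<turnstile>QmbC \<chi>"
proof -
  define B where "B = \<psi>\<langle>x := Cst c\<rangle>"
  \<comment> \<open>A variable outside \<open>M\<close> can take the place of \<open>x\<close> as
    bound variable: it is neither free nor bound in \<psi>.\<close>
  define M where "M = {x} \<union> FV \<psi> \<union> BV \<psi>"
  have finM: "finite M" by (simp add: M_def)
  have B: "B \<in> Sen \<Theta>"
    using \<psi> c by (auto simp: B_def Sen_def subst_For FV_subst_closed)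
  have w: "witness_ax Q x \<psi> c \<in> Sen \<Theta>"
    using B \<psi> by (cases Q) (auto simp: witness_ax_def Sen_def B_def)
  have For: "\<psi> \<in> For \<Theta>" "B \<in> For \<Theta>" "\<chi> \<in> For \<Theta>"
    using \<psi> B \<chi> by (auto simp: Sen_def)
  have ded: "\<Theta>, \<Gamma> \<turnstile>QmbC witness_ax Q x \<psi> c \<^bold>\<longrightarrow> \<chi>"
    using d w by (rule deduction)
  have ren: "variant (Quant Q x \<psi>) (Quant Q y (\<psi>\<langle>x := Var y\<rangle>))" if "y \<notin> M" for y
    using that by (intro variant.rename free_for_not_BV) (auto simp: M_def)
  show ?thesis
  proof (cases Q)
    case QEx
    let ?E = "Exists x \<psi>"
    have ded: "\<Theta>, \<Gamma> \<turnstile>QmbC (?E \<^bold>\<longrightarrow> B) \<^bold>\<longrightarrow> \<chi>" using ded QEx by (simp add: witness_ax_def B_def)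
    have "\<Theta>, \<Gamma> \<turnstile>QmbC B \<^bold>\<longrightarrow> \<chi>"
      using For by (intro imp_trans[OF Ax[OF _ A1] ded]) simp
    then obtain y where y: "y \<notin> M" "\<Theta>, \<Gamma> \<turnstile>QmbC fcs (Cst(c := Var y)) (B \<^bold>\<longrightarrow> \<chi>)"
      using fresh(3) finM by (rule constant_generalization)
    then have "\<Theta>, \<Gamma> \<turnstile>QmbC \<psi>\<langle>x := Var y\<rangle> \<^bold>\<longrightarrow> \<chi>"
      using fresh by (simp add: B_def fcs_witness fcs_upd M_def)
    then have "\<Theta>, \<Gamma> \<turnstile>QmbC Exists y (\<psi>\<langle>x := Var y\<rangle>) \<^bold>\<longrightarrow> \<chi>"
      using \<chi> by (intro ExIn) (auto simp: Sen_def)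
    moreover have "\<Theta>, \<Gamma> \<turnstile>QmbC ?E \<^bold>\<longrightarrow> Exists y (\<psi>\<langle>x := Var y\<rangle>)"
      using ren[OF y(1)] QEx For by (intro Ax Ax14) (auto intro: subst_For)
    ultimately have "\<Theta>, \<Gamma> \<turnstile>QmbC ?E \<^bold>\<longrightarrow> \<chi>" by (blast intro: imp_trans)
    \<comment> \<open>Classical case distinction: either the existential formula holds, or it
      implies everything, in particular its witness; \<chi> follows both times.\<close>
    moreover have "\<Theta>, \<Gamma> \<turnstile>QmbC ?E \<^bold>\<or> (?E \<^bold>\<longrightarrow> B)"
      using For by (intro Ax A9) simp
    ultimately show ?thesis using ded by (blast intro: disj_cases)
  next
    case QAll
    let ?A = "Forall x \<psi>"
    have ded: "\<Theta>, \<Gamma> \<turnstile>QmbC (B \<^bold>\<longrightarrow> ?A) \<^bold>\<longrightarrow> \<chi>" using ded QAll by (simp add: witness_ax_def B_def)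
    have A: "\<Theta>, \<Gamma> \<turnstile>QmbC ?A \<^bold>\<longrightarrow> \<chi>"
      using For by (intro imp_trans[OF Ax[OF _ A1] ded]) simp
    \<comment> \<open>The goal is reached by cases from \<chi> or \<chi> \<rightarrow>
      \<open>?A\<close>. In the second case \<open>B \<rightarrow> ?A\<close> leads through \<chi>
      and \<open>?A\<close> to \<open>B\<close>, so \<open>B\<close> holds anyway; generalizing on
      the constant gives \<open>?A\<close>, and from it \<chi>.\<close>
    let ?\<Gamma> = "insert (\<chi> \<^bold>\<longrightarrow> ?A) \<Gamma>"
    have "\<Theta>, ?\<Gamma> \<turnstile>QmbC (B \<^bold>\<longrightarrow> ?A) \<^bold>\<longrightarrow> \<chi>" using ded by (rule derives_mono) blast
    moreover have "\<Theta>, ?\<Gamma> \<turnstile>QmbC \<chi> \<^bold>\<longrightarrow> ?A" using For by (intro Prem) auto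
    moreover have "\<Theta>, ?\<Gamma> \<turnstile>QmbC ?A \<^bold>\<longrightarrow> B"
      using For c unfolding B_def by (intro Ax Ax13) (auto intro: free_for_closed)
    ultimately have "\<Theta>, ?\<Gamma> \<turnstile>QmbC (B \<^bold>\<longrightarrow> ?A) \<^bold>\<longrightarrow> B" by (blast intro: imp_trans)
    moreover have "\<Theta>, ?\<Gamma> \<turnstile>QmbC B \<^bold>\<or> (B \<^bold>\<longrightarrow> ?A)" using For by (intro Ax A9) simp
    moreover have "\<Theta>, ?\<Gamma> \<turnstile>QmbC B \<^bold>\<longrightarrow> B" using For by (simp add: imp_refl)
    ultimately have "\<Theta>, ?\<Gamma> \<turnstile>QmbC B" by (blast intro: disj_cases)
    moreover have cA: "\<chi> \<^bold>\<longrightarrow> ?A \<in> Sen \<Theta>" using \<chi> \<psi> QAll by (auto simp: Sen_def)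
    ultimately have "\<Theta>, \<Gamma> \<turnstile>QmbC (\<chi> \<^bold>\<longrightarrow> ?A) \<^bold>\<longrightarrow> B" by (rule deduction)
    then obtain y where y: "y \<notin> M" "\<Theta>, \<Gamma> \<turnstile>QmbC fcs (Cst(c := Var y)) ((\<chi> \<^bold>\<longrightarrow> ?A) \<^bold>\<longrightarrow> B)"
      using fresh(3) finM by (rule constant_generalization)
    then have "\<Theta>, \<Gamma> \<turnstile>QmbC (\<chi> \<^bold>\<longrightarrow> ?A) \<^bold>\<longrightarrow> \<psi>\<langle>x := Var y\<rangle>"
      using fresh by (simp add: B_def fcs_witness fcs_upd M_def)
    then have "\<Theta>, \<Gamma> \<turnstile>QmbC (\<chi> \<^bold>\<longrightarrow> ?A) \<^bold>\<longrightarrow> Forall y (\<psi>\<langle>x := Var y\<rangle>)"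
      using cA by (intro AllIn) (auto simp: Sen_def)
    moreover have "\<Theta>, \<Gamma> \<turnstile>QmbC Forall y (\<psi>\<langle>x := Var y\<rangle>) \<^bold>\<longrightarrow> ?A"
      using ren[OF y(1)] QAll For by (intro Ax Ax14) (auto intro: subst_For variant.sym)
    ultimately have "\<Theta>, \<Gamma> \<turnstile>QmbC (\<chi> \<^bold>\<longrightarrow> ?A) \<^bold>\<longrightarrow> \<chi>" using A by (blast intro: imp_trans)
    moreover have "\<Theta>, \<Gamma> \<turnstile>QmbC \<chi> \<^bold>\<or> (\<chi> \<^bold>\<longrightarrow> ?A)" using For by (intro Ax A9) simp
    moreover have "\<Theta>, \<Gamma> \<turnstile>QmbC \<chi> \<^bold>\<longrightarrow> \<chi>" using For by (simp add: imp_refl)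
    ultimately show ?thesis by (blast intro: disj_cases)
  qed
qed

text \<open>One constant for every quantified formula of the extended language itself: the language with
  all its witnesses is obtained at once, as a nested datatype.\<close>

datatype ('c, 'f, 'p) hc = Base 'c | Hen quant nat "(('c, 'f, 'p) hc, 'f, 'p) fm"

text \<open>Nesting depth; recursion through the nested type passes through \<open>map_fm\<close>,
  and \<open>insert 0\<close> provides for formulas without constants.\<close>

primrec rank :: "('c, 'f, 'p) hc \<Rightarrow> nat" where
  "rank (Base c) = 0"
| "rank (Hen Q x \<psi>) = Suc (Max (insert 0 (set1_fm (map_fm rank id id \<psi>))))"

lemma finite_set1_trm [simp]: "finite (set1_trm t)"
  by (induction t) auto

lemma finite_set1_fm [simp]: "finite (set1_fm \<phi>)"
  by (induction \<phi>) auto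

lemma rank_Hen: "c \<in> set1_fm \<psi> \<Longrightarrow> rank c < rank (Hen Q x \<psi>)"
  by (auto simp: fm.set_map less_Suc_eq_le intro!: Max_ge)

section \<open>The extended signature and its witnessing axioms\<close>

definition fn_names :: "('c, 'f, 'p) sig \<Rightarrow> 'f set" where
  "fn_names \<Theta> = (\<Union>n\<in>{1..}. fn \<Theta> n)"

definition pr_names :: "('c, 'f, 'p) sig \<Rightarrow> 'p set" where
  "pr_names \<Theta> = (\<Union>n\<in>{1..}. pr \<Theta> n)"

text \<open>A witnessing constant is restricted by the names it contains, not by well-formedness of
  its formula. That already bounds the number of constants when the types of names are
  large.\<close>

definition hen_sig :: "('c, 'f, 'p) sig \<Rightarrow> (('c, 'f, 'p) hc, 'f, 'p) sig" where
  "hen_sig \<Theta> = \<lparr>cn = {c. set1_hc c \<subseteq> cn \<Theta> \<and> set2_hc c \<subseteq> fn_names \<Theta> \<and> set3_hc c \<subseteq> pr_names \<Theta>},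
    fn = fn \<Theta>, pr = pr \<Theta>\<rparr>"

lemma hen_sig_simps [simp]: "fn (hen_sig \<Theta>) = fn \<Theta>" "pr (hen_sig \<Theta>) = pr \<Theta>"
    "Base c \<in> cn (hen_sig \<Theta>) \<longleftrightarrow> c \<in> cn \<Theta>"
  by (auto simp: hen_sig_def)

lemma names_trm: "t \<in> Ter \<Theta> \<Longrightarrow> set1_trm t \<subseteq> cn \<Theta> \<and> set2_trm t \<subseteq> fn_names \<Theta>"
proof (induction rule: Ter.induct)
  case (3 ts f)
  then have "f \<in> fn_names \<Theta>" by (auto simp: fn_names_def Suc_le_eq intro!: bexI[of _ "length ts"])
  then show ?case using 3 by auto
qed auto

lemma names_fm:
  "\<phi> \<in> For \<Theta> \<Longrightarrow> set1_fm \<phi> \<subseteq> cn \<Theta> \<and> set2_fm \<phi> \<subseteq> fn_names \<Theta> \<and> set3_fm \<phi> \<subseteq> pr_names \<Theta>"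
proof (induction rule: For.induct)
  case (1 ts P)
  then have "P \<in> pr_names \<Theta>" by (auto simp: pr_names_def Suc_le_eq intro!: bexI[of _ "length ts"])
  then show ?case using 1 names_trm by fastforce
qed auto

lemma Hen_cn: "\<psi> \<in> For (hen_sig \<Theta>) \<Longrightarrow> Hen Q x \<psi> \<in> cn (hen_sig \<Theta>)"
  using names_fm[of \<psi> "hen_sig \<Theta>"] unfolding fn_names_def pr_names_def hen_sig_def by fastforce

definition hen_axioms :: "('c, 'f, 'p) sig \<Rightarrow> (('c, 'f, 'p) hc, 'f, 'p) fm set" where
  "hen_axioms \<Theta> = {witness_ax Q x \<psi> (Hen Q x \<psi>) | Q x \<psi>. Quant Q x \<psi> \<in> Sen (hen_sig \<Theta>)}"

abbreviation base :: "('c, 'f, 'p) fm \<Rightarrow> (('c, 'f, 'p) hc, 'f, 'p) fm" where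
  "base \<equiv> fcs (\<lambda>c. Cst (Base c))"

lemma set1_base_trm: "set1_trm (tcs (\<lambda>c. Cst (Base c)) t) \<subseteq> range Base"
  by (induction t) auto

lemma set1_base: "set1_fm (base \<phi>) \<subseteq> range Base"
  by (induction \<phi>) (use set1_base_trm in fastforce)+

lemma base_For: "\<phi> \<in> For \<Theta> \<Longrightarrow> base \<phi> \<in> For (hen_sig \<Theta>)"
  by (erule fcs_For) auto

lemma set1_witness_ax: "set1_fm (witness_ax Q x \<psi> c) \<subseteq> insert c (set1_fm \<psi>)"
  using set1_subst[of \<psi> x "Cst c"] by (cases Q) (auto simp: witness_ax_def)

text \<open>By compactness finitely many witnessing axioms matter, and they are removed in order of
  decreasing rank. A constant of greatest rank cannot occur in another of these axioms, whose own
  constant would otherwise have greater rank still.\<close>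

lemma hen_axioms_conservative:
  assumes "hen_sig \<Theta>, base ` \<Gamma> \<union> hen_axioms \<Theta> \<turnstile>QmbC base \<chi>" and \<chi>: "base \<chi> \<in> Sen (hen_sig \<Theta>)"
  shows "hen_sig \<Theta>, base ` \<Gamma> \<turnstile>QmbC base \<chi>"
proof -
  \<comment> \<open>The axioms are indexed by triples so that the constant belonging to an axiom can
    be read off its index.\<close>
  define ax :: "quant \<times> nat \<times> (('a, 'b, 'c) hc, 'b, 'c) fm \<Rightarrow> (('a, 'b, 'c) hc, 'b, 'c) fm"
    where "ax = (\<lambda>(Q, x, \<psi>). witness_ax Q x \<psi> (Hen Q x \<psi>))"
  define wit :: "quant \<times> nat \<times> (('a, 'b, 'c) hc, 'b, 'c) fm \<Rightarrow> ('a, 'b, 'c) hc"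
    where "wit = (\<lambda>(Q, x, \<psi>). Hen Q x \<psi>)"
  define I where "I = {(Q, x, \<psi>). Quant Q x \<psi> \<in> Sen (hen_sig \<Theta>)}"
  have elim: "hen_sig \<Theta>, base ` \<Gamma> \<turnstile>QmbC base \<chi>"
    if "finite J" "J \<subseteq> I" "hen_sig \<Theta>, base ` \<Gamma> \<union> ax ` J \<turnstile>QmbC base \<chi>" for J
    using that
  proof (induction J rule: finite_psubset_induct)
    case (psubset J)
    show ?case
    proof (cases "J = {}")
      case False
      have "Max (rank ` wit ` J) \<in> rank ` wit ` J" using psubset.hyps False by simp
      then obtain m where m: "m \<in> J" "rank (wit m) = Max (rank ` wit ` J)" by auto
      have max: "rank (wit k) \<le> rank (wit m)" if "k \<in> J" for k
        using that psubset.hyps m(2) by simp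
      obtain Q x \<psi> where mdef: "m = (Q, x, \<psi>)" by (cases m)
      have \<psi>: "Quant Q x \<psi> \<in> Sen (hen_sig \<Theta>)" using m(1) psubset.prems(1) by (auto simp: I_def mdef)
      have fresh: "wit m \<notin> set1_fm (ax k)" if k: "k \<in> J - {m}" for k
      proof
        assume in_ax: "wit m \<in> set1_fm (ax k)"
        obtain Q' x' \<psi>' where kdef: "k = (Q', x', \<psi>')" by (cases k)
        have "wit m \<noteq> wit k" using k by (auto simp: mdef kdef wit_def)
        then have "wit m \<in> set1_fm \<psi>'"
          using in_ax set1_witness_ax by (fastforce simp: ax_def kdef wit_def)
        from rank_Hen[OF this, of Q' x'] max[of k] k show False by (simp add: kdef wit_def)
      qed
      have "base ` \<Gamma> \<union> ax ` J = insert (ax m) (base ` \<Gamma> \<union> ax ` (J - {m}))"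
        using m(1) by auto
      with psubset.prems(2) have "hen_sig \<Theta>, insert (ax m) (base ` \<Gamma> \<union> ax ` (J - {m})) \<turnstile>QmbC base \<chi>"
        by simp
      then have "hen_sig \<Theta>, base ` \<Gamma> \<union> ax ` (J - {m}) \<turnstile>QmbC base \<chi>"
        unfolding ax_def mdef prod.case
      proof (rule witness_ax_conservative[OF _ \<psi> \<chi>], fold ax_def mdef)
        show "Hen Q x \<psi> \<in> cn (hen_sig \<Theta>)" using \<psi> by (auto simp: Sen_def intro: Hen_cn)
        show "Hen Q x \<psi> \<notin> set1_fm \<psi>" using rank_Hen by blast
        show "Hen Q x \<psi> \<notin> set1_fm (base \<chi>)" using set1_base by blast
        show "Hen Q x \<psi> \<notin> set1_fm \<gamma>" if "\<gamma> \<in> base ` \<Gamma> \<union> ax ` (J - {m})" for \<gamma>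
          using that
        proof
          assume "\<gamma> \<in> base ` \<Gamma>"
          then show ?thesis using set1_base by blast
        next
          assume "\<gamma> \<in> ax ` (J - {m})"
          then show ?thesis using fresh by (auto simp: wit_def mdef)
        qed
      qed
      then show ?thesis using psubset.IH[of "J - {m}"] m(1) psubset.prems(1) by blast
    qed (use psubset.prems in simp)
  qed
  have "hen_axioms \<Theta> = ax ` I" unfolding hen_axioms_def ax_def I_def by (auto simp: image_iff) blast
  then obtain \<Gamma>' where \<Gamma>': "finite \<Gamma>'" "\<Gamma>' \<subseteq> base ` \<Gamma> \<union> ax ` I" "hen_sig \<Theta>, \<Gamma>' \<turnstile>QmbC base \<chi>"
    using derives_compact[OF assms(1)] by auto
  have "finite (\<Gamma>' \<inter> ax ` I)" "\<Gamma>' \<inter> ax ` I \<subseteq> ax ` I" using \<Gamma>'(1) by auto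
  from finite_subset_image[OF this]
  obtain J where J: "finite J" "J \<subseteq> I" "\<Gamma>' \<inter> ax ` I = ax ` J" by blast
  then have "hen_sig \<Theta>, base ` \<Gamma> \<union> ax ` J \<turnstile>QmbC base \<chi>"
    using \<Gamma>'(2) by (intro derives_mono[OF \<Gamma>'(3)]) auto
  with J show ?thesis by (intro elim)
qed

text \<open>All witnessing constants are sent to a single variable unknown to the derivation. They
  may occur in its intermediate lines, but not in premises and conclusion, which therefore come back
  unchanged.\<close>

lemma base_conservative:
  assumes "hen_sig \<Theta>, base ` \<Gamma> \<turnstile>QmbC base \<chi>"
  shows "\<Theta>, \<Gamma> \<turnstile>QmbC \<chi>"
proof -
  obtain N where N: "finite N" "\<And>\<theta>. avoids \<theta> N \<Longrightarrow> \<forall>c\<in>cn (hen_sig \<Theta>). \<theta> c \<in> Ter \<Theta>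
      \<Longrightarrow> \<Theta>, fcs \<theta> ` base ` \<Gamma> \<turnstile>QmbC fcs \<theta> (base \<chi>)"
    using derives_fcs[OF assms, of \<Theta>] by auto
  obtain y where y: "y \<notin> N" using N(1) ex_new_if_finite[of N] by auto
  define \<theta> :: "('a, 'b, 'c) hc \<Rightarrow> ('a, 'b) trm" where "\<theta> = case_hc Cst (\<lambda>_ _ _. Var y)"
  have "fcs \<theta> (base \<phi>) = \<phi>" for \<phi> :: "('a, 'b, 'c) fm"
    by (simp add: fcs_fcs \<theta>_def o_def)
  moreover have "avoids \<theta> N" using y by (auto simp: avoids_def \<theta>_def split: hc.splits)
  moreover have "\<forall>c\<in>cn (hen_sig \<Theta>). \<theta> c \<in> Ter \<Theta>" by (auto simp: \<theta>_def split: hc.splits)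
  ultimately show ?thesis using N(2)[of \<theta>] by (simp add: image_image)
qed

section \<open>The canonical structure\<close>

text \<open>If \<alpha> is not in the maximal set, adding it yields \<chi>, and the deduction
  theorem turns this into \<alpha> \<rightarrow> \<chi>. Chains are harmless because derivations use
  finitely many premises.\<close>

lemma lindenbaum:
  assumes "\<not> (\<Theta>, G \<turnstile>QmbC \<chi>)"
  obtains K where "G \<subseteq> K" "\<not> (\<Theta>, K \<turnstile>QmbC \<chi>)"
    "\<And>\<alpha>. \<alpha> \<in> Sen \<Theta> \<Longrightarrow> \<Theta>, K \<turnstile>QmbC \<alpha> \<or> \<Theta>, K \<turnstile>QmbC \<alpha> \<^bold>\<longrightarrow> \<chi>"
proof -
  define A where "A = {K. G \<subseteq> K \<and> \<not> (\<Theta>, K \<turnstile>QmbC \<chi>)}"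
  have "\<Union>C \<in> A" if C: "C \<noteq> {}" "subset.chain A C" for C
  proof -
    have "C \<subseteq> A" using C(2) by (simp add: subset.chain_def)
    have "\<not> (\<Theta>, \<Union>C \<turnstile>QmbC \<chi>)"
    proof
      assume "\<Theta>, \<Union>C \<turnstile>QmbC \<chi>"
      from derives_compact[OF this]
      obtain \<Gamma> where \<Gamma>: "finite \<Gamma>" "\<Gamma> \<subseteq> \<Union>C" "\<Theta>, \<Gamma> \<turnstile>QmbC \<chi>" by blast
      from finite_subset_Union_chain[OF \<Gamma>(1,2) C(1,2)] obtain B where "B \<in> C" "\<Gamma> \<subseteq> B" by blast
      with \<open>C \<subseteq> A\<close> derives_mono[OF \<Gamma>(3)] show False by (auto simp: A_def)
    qed
    moreover have "G \<subseteq> \<Union>C" using C(1) \<open>C \<subseteq> A\<close> by (auto simp: A_def)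
    ultimately show ?thesis by (simp add: A_def)
  qed
  moreover have "A \<noteq> {}" using assms by (auto simp: A_def)
  ultimately obtain K where K: "K \<in> A" "\<And>X. X \<in> A \<Longrightarrow> K \<subseteq> X \<Longrightarrow> X = K"
    using subset_Zorn_nonempty[of A] by blast
  show thesis
  proof (rule that)
    show "G \<subseteq> K" "\<not> (\<Theta>, K \<turnstile>QmbC \<chi>)" using K(1) by (auto simp: A_def)
    show "\<Theta>, K \<turnstile>QmbC \<alpha> \<or> \<Theta>, K \<turnstile>QmbC \<alpha> \<^bold>\<longrightarrow> \<chi>" if \<alpha>: "\<alpha> \<in> Sen \<Theta>" for \<alpha>
    proof (cases "\<Theta>, insert \<alpha> K \<turnstile>QmbC \<chi>")
      case True
      then show ?thesis using \<alpha> by (blast intro: deduction)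
    next
      case False
      then have "insert \<alpha> K \<in> A" using K(1) by (auto simp: A_def)
      then have "insert \<alpha> K = K" using K(2) by blast
      then show ?thesis using \<alpha> by (auto simp: Sen_def intro!: Prem)
    qed
  qed
qed

text \<open>The type of domain elements is prescribed, so terms enter it through an injection
  \<open>h\<close>.\<close>

locale henkin_set =
  fixes \<Theta> :: "('c, 'f, 'p) sig" and K :: "(('c, 'f, 'p) hc, 'f, 'p) fm set" and \<chi>
    and h :: "(('c, 'f, 'p) hc, 'f) trm \<Rightarrow> 'u"
  assumes \<chi>_Sen: "\<chi> \<in> Sen (hen_sig \<Theta>)"
    and \<chi>_K: "\<not> (hen_sig \<Theta>, K \<turnstile>QmbC \<chi>)"
    and K_dec: "\<And>\<alpha>. \<alpha> \<in> Sen (hen_sig \<Theta>) \<Longrightarrow> hen_sig \<Theta>, K \<turnstile>QmbC \<alpha> \<or> hen_sig \<Theta>, K \<turnstile>QmbC \<alpha> \<^bold>\<longrightarrow> \<chi>"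
    and K_hen: "hen_axioms \<Theta> \<subseteq> K"
    and h_inj: "inj_on h (Ter (hen_sig \<Theta>))"
begin

abbreviation "\<Sigma> \<equiv> hen_sig \<Theta>"

abbreviation pv :: "(('c, 'f, 'p) hc, 'f, 'p) fm \<Rightarrow> bool" where
  "pv \<phi> \<equiv> \<Sigma>, K \<turnstile>QmbC \<phi>"

lemma Sen_simps [simp]:
  "Unary g \<alpha> \<in> Sen \<Sigma> \<longleftrightarrow> \<alpha> \<in> Sen \<Sigma>"
  "Binary b \<alpha> \<beta> \<in> Sen \<Sigma> \<longleftrightarrow> \<alpha> \<in> Sen \<Sigma> \<and> \<beta> \<in> Sen \<Sigma>"
  by (auto simp: Sen_def)

lemma Sen_For: "\<alpha> \<in> Sen \<Sigma> \<Longrightarrow> \<alpha> \<in> For \<Sigma>"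
  by (simp add: Sen_def)

text \<open>The crucial case is unprovable \<alpha>, where \<alpha> \<rightarrow> \<chi> is
  provable. Were \<alpha> \<rightarrow> \<beta> unprovable too, it would imply \<chi> as well, and
  (A9) would yield \<chi>.\<close>

lemma pv_imp: "\<alpha> \<in> Sen \<Sigma> \<Longrightarrow> \<beta> \<in> Sen \<Sigma> \<Longrightarrow> pv (\<alpha> \<^bold>\<longrightarrow> \<beta>) \<longleftrightarrow> (pv \<alpha> \<longrightarrow> pv \<beta>)"
proof
  assume s: "\<alpha> \<in> Sen \<Sigma>" "\<beta> \<in> Sen \<Sigma>" and "pv \<alpha> \<longrightarrow> pv \<beta>"
  moreover have "pv (\<alpha> \<^bold>\<or> (\<alpha> \<^bold>\<longrightarrow> \<beta>))" using s by (auto intro!: Ax A9 simp: Sen_For)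
  ultimately show "pv (\<alpha> \<^bold>\<longrightarrow> \<beta>)"
    using K_dec[of \<alpha>] K_dec[of "\<alpha> \<^bold>\<longrightarrow> \<beta>"] \<chi>_K by (auto intro: imp_const Sen_For dest: disj_cases)
qed (auto intro: MP)

lemma pv_or: "\<alpha> \<in> Sen \<Sigma> \<Longrightarrow> \<beta> \<in> Sen \<Sigma> \<Longrightarrow> pv (\<alpha> \<^bold>\<or> \<beta>) \<longleftrightarrow> pv \<alpha> \<or> pv \<beta>"
proof
  assume s: "\<alpha> \<in> Sen \<Sigma>" "\<beta> \<in> Sen \<Sigma>"
  show "pv \<alpha> \<or> pv \<beta>" if "pv (\<alpha> \<^bold>\<or> \<beta>)"
    using that K_dec[OF s(1)] K_dec[OF s(2)] \<chi>_K by (blast dest: disj_cases)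
  show "pv (\<alpha> \<^bold>\<or> \<beta>)" if "pv \<alpha> \<or> pv \<beta>"
    using that s by (auto intro: MP[OF _ Ax[OF _ A6]] MP[OF _ Ax[OF _ A7]] simp: Sen_For)
qed

lemma pv_and: "\<alpha> \<in> Sen \<Sigma> \<Longrightarrow> \<beta> \<in> Sen \<Sigma> \<Longrightarrow> pv (\<alpha> \<^bold>\<and> \<beta>) \<longleftrightarrow> pv \<alpha> \<and> pv \<beta>"
  by (auto intro: MP[OF _ Ax[OF _ A4]] MP[OF _ Ax[OF _ A5]] MP[OF _ MP[OF _ Ax[OF _ A3]]]
      simp: Sen_For)

lemma pv_Binary:
  "\<alpha> \<in> Sen \<Sigma> \<Longrightarrow> \<beta> \<in> Sen \<Sigma> \<Longrightarrow> pv (Binary b \<alpha> \<beta>) = bool_op b (pv \<alpha>) (pv \<beta>)"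
  by (cases b) (simp_all add: pv_imp pv_or pv_and)

text \<open>Clause (ii) forces the last two coordinates: they are the first coordinates of the
  values of the negation and of the consistency statement.\<close>

definition tvl :: "(('c, 'f, 'p) hc, 'f, 'p) fm \<Rightarrow> tv" where
  "tvl \<phi> = (pv \<phi>, pv (Neg \<phi>), pv (Circ \<phi>))"

lemma tvl_M5: assumes "\<alpha> \<in> Sen \<Sigma>" shows "tvl \<alpha> \<in> M5"
proof -
  have "pv (\<alpha> \<^bold>\<or> Neg \<alpha>)" using assms by (auto intro!: Ax A10 simp: Sen_For)
  then have "pv \<alpha> \<or> pv (Neg \<alpha>)" using assms by (simp add: pv_or)
  \<comment> \<open>The unprovable \<chi> is the conclusion that must not be reached by
    explosion.\<close>
  moreover have "pv (Circ \<alpha> \<^bold>\<longrightarrow> \<alpha> \<^bold>\<longrightarrow> Neg \<alpha> \<^bold>\<longrightarrow> \<chi>)"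
    using assms \<chi>_Sen by (auto intro!: Ax A11 simp: Sen_For)
  then have "\<not> (pv \<alpha> \<and> pv (Neg \<alpha>) \<and> pv (Circ \<alpha>))" using assms \<chi>_Sen \<chi>_K by (auto simp: pv_imp)
  ultimately show ?thesis by (simp add: tvl_def M5_def)
qed

text \<open>All three coordinates agree because being variants is a congruence and passes to the
  formulas under the two unary connectives.\<close>

lemma tvl_variant:
  assumes "variant \<phi> \<psi>" "\<phi> \<in> Sen \<Sigma>" "\<psi> \<in> Sen \<Sigma>"
  shows "tvl \<phi> = tvl \<psi>"
proof -
  have "pv \<alpha> \<longleftrightarrow> pv \<beta>" if "variant \<alpha> \<beta>" "\<alpha> \<in> Sen \<Sigma>" "\<beta> \<in> Sen \<Sigma>" for \<alpha> \<beta>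
    using that by (auto intro: variant_derives variant.sym Sen_For)
  then show ?thesis using assms by (simp add: tvl_def variant.Unary)
qed

section \<open>Closed terms as a domain\<close>

definition CT :: "(('c, 'f, 'p) hc, 'f) trm set" where
  "CT = {t \<in> Ter \<Sigma>. vars t = {}}"

lemma Hen_CT: "\<psi> \<in> For \<Sigma> \<Longrightarrow> Cst (Hen Q x \<psi>) \<in> CT"
  by (simp add: CT_def Hen_cn)

text \<open>The signature \<Theta> itself may have no closed term; a witnessing constant always
  supplies one.\<close>

lemma CT_nonempty: "CT \<noteq> {}"
  using Hen_CT[OF Sen_For[OF \<chi>_Sen]] by blast

lemma Quant_SenD: "Quant Q x \<psi> \<in> Sen \<Sigma> \<Longrightarrow> \<psi> \<in> For \<Sigma>"
  by (simp add: Sen_def)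

lemma subst_Sen: "Quant Q x \<psi> \<in> Sen \<Sigma> \<Longrightarrow> t \<in> CT \<Longrightarrow> \<psi>\<langle>x := t\<rangle> \<in> Sen \<Sigma>"
  by (auto simp: Sen_def FV_subst_closed CT_def subst_For)

lemma pv_witness: "Quant Q x \<psi> \<in> Sen \<Sigma> \<Longrightarrow> pv (witness_ax Q x \<psi> (Hen Q x \<psi>))"
  using K_hen subst_Sen[of Q x \<psi>, OF _ Hen_CT[OF Quant_SenD]]
  by (intro Prem) (auto simp: hen_axioms_def, cases Q, auto simp: witness_ax_def Sen_def)

lemma pv_Exists:
  assumes "Exists x \<psi> \<in> Sen \<Sigma>"
  shows "pv (Exists x \<psi>) \<longleftrightarrow> (\<exists>t\<in>CT. pv (\<psi>\<langle>x := t\<rangle>))"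
proof
  assume "pv (Exists x \<psi>)"
  with pv_witness[OF assms] have "pv (\<psi>\<langle>x := Cst (Hen QEx x \<psi>)\<rangle>)"
    by (auto simp: witness_ax_def intro: MP)
  then show "\<exists>t\<in>CT. pv (\<psi>\<langle>x := t\<rangle>)" using Hen_CT Quant_SenD[OF assms] by blast
next
  assume "\<exists>t\<in>CT. pv (\<psi>\<langle>x := t\<rangle>)"
  then show "pv (Exists x \<psi>)"
    using Quant_SenD[OF assms]
    by (auto intro!: MP[OF _ Ax[OF _ Ax12]] subst_For free_for_closed simp: CT_def)
qed

lemma pv_Forall:
  assumes "Forall x \<psi> \<in> Sen \<Sigma>"
  shows "pv (Forall x \<psi>) \<longleftrightarrow> (\<forall>t\<in>CT. pv (\<psi>\<langle>x := t\<rangle>))"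
proof
  assume "pv (Forall x \<psi>)"
  then show "\<forall>t\<in>CT. pv (\<psi>\<langle>x := t\<rangle>)" by (auto intro: Forall_E free_for_closed simp: CT_def)
next
  assume "\<forall>t\<in>CT. pv (\<psi>\<langle>x := t\<rangle>)"
  with pv_witness[OF assms] Hen_CT[OF Quant_SenD[OF assms]] show "pv (Forall x \<psi>)"
    by (auto simp: witness_ax_def intro: MP)
qed

text \<open>Elements outside the domain receive an arbitrary closed term, so that the translation
  below always produces closed terms.\<close>

definition denot :: "'u \<Rightarrow> (('c, 'f, 'p) hc, 'f) trm" where
  "denot a = (if a \<in> h ` CT then inv_into CT h a else (SOME t. t \<in> CT))"

lemma denot_CT: "denot a \<in> CT"
  using CT_nonempty by (auto simp: denot_def inv_into_into some_in_eq)

lemma denot_h: "t \<in> CT \<Longrightarrow> denot (h t) = t"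
  using h_inj by (auto simp: denot_def CT_def intro!: inv_into_f_f inj_on_subset[OF h_inj])

lemma h_denot: "a \<in> h ` CT \<Longrightarrow> h (denot a) = a"
  by (simp add: denot_def f_inv_into_f)

definition canon :: "('c, 'f, 'p, 'u) str" where
  "canon = \<lparr>dm = h ` CT, ic = \<lambda>c. h (Cst (Base c)), ifn = \<lambda>f as. h (Fun f (map denot as)),
    ipr = \<lambda>P as. tvl (Pred P (map denot as))\<rparr>"

lemma canon_simps [simp]:
  "dm canon = h ` CT" "ic canon c = h (Cst (Base c))" "ifn canon f as = h (Fun f (map denot as))"
  "ipr canon P as = tvl (Pred P (map denot as))"
  by (simp_all add: canon_def)

lemma structure_canon: "structure \<Theta> canon"
  unfolding structure_def
proof (intro conjI ballI allI impI)
  show "dm canon \<noteq> {}" using CT_nonempty by simp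
  show "ic canon c \<in> dm canon" if "c \<in> cn \<Theta>" for c using that by (auto simp: CT_def)
  fix n :: nat and as :: "'u list"
  assume n: "1 \<le> n" "length as = n \<and> set as \<subseteq> dm canon"
  then have as: "as \<noteq> []" by auto
  show "ifn canon f as \<in> dm canon" if "f \<in> fn \<Theta> n" for f
    using that n as denot_CT by (auto simp: CT_def)
  show "ipr canon P as \<in> M5" if "P \<in> pr \<Theta> n" for P
    using that n as denot_CT by (auto intro!: tvl_M5 simp: Sen_def CT_def)
qed

text \<open>Translates the diagram language into the witnessed one: the name of an element becomes
  the closed term that the element codes.\<close>

definition starc :: "'c + 'u \<Rightarrow> (('c, 'f, 'p) hc, 'f) trm" where
  "starc = case_sum (\<lambda>c. Cst (Base c)) denot"

abbreviation star :: "('c + 'u, 'f, 'p) fm \<Rightarrow> (('c, 'f, 'p) hc, 'f, 'p) fm" where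
  "star \<equiv> fcs starc"

lemma starc_simps [simp]: "starc (Inl c) = Cst (Base c)" "starc (Inr a) = denot a"
  by (simp_all add: starc_def)

lemma starc_closed [simp]: "vars (starc c) = {}"
  using denot_CT by (cases c) (auto simp: CT_def)

abbreviation "T \<equiv> Ter (diag_sig \<Theta> (dm canon))"
abbreviation "F \<equiv> For (diag_sig \<Theta> (dm canon))"
abbreviation "S \<equiv> Sen (diag_sig \<Theta> (dm canon))"

lemma starc_Ter: "c \<in> cn (diag_sig \<Theta> A) \<Longrightarrow> starc c \<in> Ter \<Sigma>"
  using denot_CT by (auto simp: diag_sig_def CT_def)

lemma star_Sen: "\<phi> \<in> Sen (diag_sig \<Theta> A) \<Longrightarrow> star \<phi> \<in> Sen \<Sigma>"
  unfolding Sen_def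
  by (auto simp: FV_fcs_closed intro!: fcs_For[where \<Theta> = "diag_sig \<Theta> A"] starc_Ter)
    (auto simp: diag_sig_def)

lemma star_term_CT: "t \<in> T \<Longrightarrow> tcs starc (tsub (\<lambda>x. name (\<mu> x)) t) \<in> CT"
proof (induction rule: Ter.induct)
  case (3 ts f)
  then show ?case by (auto simp: CT_def diag_sig_def)
qed (use denot_CT starc_Ter in \<open>auto simp: CT_def\<close>)

lemma val_star:
  "t \<in> T \<Longrightarrow> assignment canon \<mu> \<Longrightarrow>
    val (diag_str canon) \<mu> t = h (tcs starc (tsub (\<lambda>x. name (\<mu> x)) t))"
proof (induction rule: Ter.induct)
  case (1 x)
  then show ?case by (simp add: assignment_def h_denot)
next
  case (2 c)
  then show ?case by (auto simp: diag_sig_def diag_str_def h_denot)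
next
  case (3 ts f)
  have "map denot (map (val (diag_str canon) \<mu>) ts) = map (\<lambda>t. tcs starc (tsub (\<lambda>x. name (\<mu> x)) t)) ts"
    using 3 by (auto simp: denot_h star_term_CT)
  then have "h (Fun f (map denot (map (val (diag_str canon) \<mu>) ts))) =
      h (Fun f (map (\<lambda>t. tcs starc (tsub (\<lambda>x. name (\<mu> x)) t)) ts))" by (simp only:)
  moreover have "ifn (diag_str canon) = ifn canon" by (simp add: diag_str_def)
  ultimately show ?case by (simp add: o_def)
qed

lemma star_fsub: "star (fsub \<sigma> \<phi>) = fsub (tcs starc \<circ> \<sigma>) (star \<phi>)"
  by (rule fcs_fsub) simp

lemma star_inst: "star (inst \<mu> \<phi>) = fsub (\<lambda>x. denot (\<mu> x)) (star \<phi>)"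
  unfolding inst_def by (simp add: star_fsub o_def)

text \<open>Since the domain consists of closed terms, both sides of (vi) are literally the same sentence
  of the witnessed language.\<close>

lemma star_inst_subst:
  assumes "t \<in> T" "free_for t z \<phi>" "assignment canon \<mu>"
  shows "star (inst \<mu> (\<phi>\<langle>z := t\<rangle>)) = star (inst \<mu> (\<phi>\<langle>z := name (val (diag_str canon) \<mu> t)\<rangle>))"
  using assms unfolding inst_def
  by (simp add: fsub_subst free_for_closed star_fsub)
    (auto simp: val_star denot_h star_term_CT o_def intro!: fsub_cong)

definition canon_v :: "('c + 'u, 'f, 'p) fm \<Rightarrow> tv" where
  "canon_v \<phi> = tvl (star \<phi>)"

lemma canon_v_subst:
  assumes "t \<in> T" "assignment canon \<mu>" "free_for t z \<phi>"
  shows "canon_v (inst \<mu> (\<phi>\<langle>z := t\<rangle>)) = canon_v (inst \<mu> (\<phi>\<langle>z := name (val (diag_str canon) \<mu> t)\<rangle>))"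
  using star_inst_subst[OF assms(1,3,2)] by (simp add: canon_v_def)

lemma star_subst_name: "star (\<phi>\<langle>x := name a\<rangle>) = (star \<phi>)\<langle>x := denot a\<rangle>"
  by (simp add: fcs_subst)

text \<open>A valuation is constrained but not computed, so provability serves as one directly, and
  checking the clauses takes the place of a truth lemma.\<close>

lemma valuation_canon: "valuation \<Theta> canon canon_v"
  unfolding valuation_def Let_def
proof (intro conjI ballI allI impI)
  show "canon_v \<phi> \<in> M5" if "\<phi> \<in> S" for \<phi>
    using that by (simp add: canon_v_def tvl_M5 star_Sen)
next
  fix P ts \<mu>
  assume a: "Pred P ts \<in> S \<and> assignment canon \<mu>"
  have "denot (val (diag_str canon) \<mu> t) = tcs starc t" if "t \<in> set ts" for t
  proof -
    have "t \<in> T" "vars t = {}" using a that by (auto simp: Sen_def)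
    then show ?thesis using a val_star star_term_CT[of t \<mu>] by (simp add: denot_h tsub_closed)
  qed
  then show "canon_v (Pred P ts) = ipr canon P (map (val (diag_str canon) \<mu>) ts)"
    by (simp add: canon_v_def) (metis (mono_tags, lifting) comp_apply list.map_cong0)
next
  show "canon_v (Unary g \<phi>) \<in> M5_un g (canon_v \<phi>)" if "\<phi> \<in> S" for g \<phi>
    using that star_Sen[OF that] tvl_M5[of "Unary g (star \<phi>)"]
    by (cases g) (auto simp: canon_v_def tvl_def)
next
  show "canon_v (Binary b \<phi> \<psi>) \<in> M5_bin b (canon_v \<phi>) (canon_v \<psi>)" if "\<phi> \<in> S" "\<psi> \<in> S" for b \<phi> \<psi>
    using that star_Sen[OF that(1)] star_Sen[OF that(2)] tvl_M5[of "Binary b (star \<phi>) (star \<psi>)"]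
    by (auto simp: canon_v_def M5_bin_def) (auto simp: tvl_def pv_Binary)
next
  show "p1 (canon_v (Forall x \<phi>)) = (\<forall>a\<in>dm canon. p1 (canon_v (\<phi>\<langle>x := name a\<rangle>)))"
    if "Forall x \<phi> \<in> S" for x \<phi>
    using pv_Forall[of x "star \<phi>"] star_Sen[OF that] 
    by (simp add: canon_v_def tvl_def star_subst_name denot_h)
next
  show "p1 (canon_v (Exists x \<phi>)) = (\<exists>a\<in>dm canon. p1 (canon_v (\<phi>\<langle>x := name a\<rangle>)))"
    if "Exists x \<phi> \<in> S" for x \<phi>
    using pv_Exists[of x "star \<phi>"] star_Sen[OF that] 
    by (simp add: canon_v_def tvl_def star_subst_name denot_h)
next
  show "canon_v \<phi> = canon_v \<psi>" if "\<phi> \<in> S" "\<psi> \<in> S" "variant \<phi> \<psi>" for \<phi> \<psi>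
    using that by (simp add: canon_v_def tvl_variant variant_fcs star_Sen)
next
  fix t z \<mu> b g \<phi>
  assume "t \<in> T" "assignment canon \<mu> \<and> b = val (diag_str canon) \<mu> t"
    and "free_for t z \<phi> \<and> canon_v (inst \<mu> (\<phi>\<langle>z := t\<rangle>)) = canon_v (inst \<mu> (\<phi>\<langle>z := name b\<rangle>))"
  then show "canon_v (inst \<mu> ((Unary g \<phi>)\<langle>z := t\<rangle>)) = canon_v (inst \<mu> ((Unary g \<phi>)\<langle>z := name b\<rangle>))"
    using canon_v_subst[of t \<mu> z "Unary g \<phi>"] by simp
next
  fix t z \<mu> b g \<phi> \<psi>
  assume "t \<in> T" "assignment canon \<mu> \<and> b = val (diag_str canon) \<mu> t"
    and "free_for t z \<phi> \<and> free_for t z \<psi> \<and>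
      canon_v (inst \<mu> (\<phi>\<langle>z := t\<rangle>)) = canon_v (inst \<mu> (\<phi>\<langle>z := name b\<rangle>)) \<and>
      canon_v (inst \<mu> (\<psi>\<langle>z := t\<rangle>)) = canon_v (inst \<mu> (\<psi>\<langle>z := name b\<rangle>))"
  then show "canon_v (inst \<mu> ((Binary g \<phi> \<psi>)\<langle>z := t\<rangle>)) = canon_v (inst \<mu> ((Binary g \<phi> \<psi>)\<langle>z := name b\<rangle>))"
    using canon_v_subst[of t \<mu> z "Binary g \<phi> \<psi>"] by simp
next
  fix t z \<mu> b Q x \<phi>
  assume "t \<in> T" "assignment canon \<mu> \<and> b = val (diag_str canon) \<mu> t"
    and "free_for t z \<phi> \<and> x \<noteq> z \<and> x \<notin> vars t \<and>
      (\<forall>a\<in>dm canon. canon_v (inst (\<mu>(x := a)) (\<phi>\<langle>z := t\<rangle>)) =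
        canon_v (inst (\<mu>(x := a)) (\<phi>\<langle>z := name b\<rangle>)))"
  then show "canon_v (inst \<mu> ((Quant Q x \<phi>)\<langle>z := t\<rangle>)) = canon_v (inst \<mu> ((Quant Q x \<phi>)\<langle>z := name b\<rangle>))"
    using canon_v_subst[of t \<mu> z "Quant Q x \<phi>"] by simp
qed

lemma canon_v_embed: "canon_v (inst \<mu> (embed \<phi>)) = tvl (fsub (\<lambda>x. denot (\<mu> x)) (base \<phi>))"
  by (simp add: canon_v_def star_inst embed_fcs fcs_fcs o_def)

text \<open>A premise may be open and must be designated under every assignment; its closed
  instances are provable along with it.\<close>

lemma canon_v_premise:
  assumes "pv (base \<gamma>)"
  shows "canon_v (inst \<mu> (embed \<gamma>)) \<in> D5"
proof -
  have d: "denot a \<in> Ter \<Sigma>" "vars (denot a) = {}" for a using denot_CT by (auto simp: CT_def)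
  have p: "pv (fsub (\<lambda>x. denot (\<mu> x)) (base \<gamma>))" using assms d by (intro derives_fsub)
  then have "fsub (\<lambda>x. denot (\<mu> x)) (base \<gamma>) \<in> Sen \<Sigma>"
    using derives_For[OF p] d by (simp add: Sen_def FV_fsub ground_def)
  from tvl_M5[OF this] p show ?thesis unfolding canon_v_embed D5_def by (simp add: tvl_def)
qed

lemma not_consequence:
  assumes "\<chi> = base \<phi>" "\<And>\<gamma>. \<gamma> \<in> \<Gamma> \<Longrightarrow> pv (base \<gamma>)"
  shows "\<not> consequence \<Theta> canon \<Gamma> \<phi>"
proof
  assume c: "consequence \<Theta> canon \<Gamma> \<phi>"
  \<comment> \<open>Any assignment refutes \<chi>: being a sentence, it is left unchanged by
    substitution.\<close>
  obtain a where "a \<in> h ` CT" using CT_nonempty by auto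
  then have "assignment canon (\<lambda>_. a)" by (simp add: assignment_def)
  then have "canon_v (inst (\<lambda>_. a) (embed \<phi>)) \<in> D5"
    using c valuation_canon assms(2) canon_v_premise unfolding consequence_def by blast
  then have "pv (fsub (\<lambda>x. denot a) \<chi>)" unfolding canon_v_embed assms(1) by (simp add: D5_def tvl_def)
  then show False using \<chi>_Sen \<chi>_K by (simp add: fsub_closed Sen_def)
qed

end

section \<open>The cardinality of the canonical domain\<close>

text \<open>Injectivity is asked only at members of the first list, which is what the induction
  hypothesis on subterms provides.\<close>

lemma map_inj_on_left:
  "(\<And>x y. x \<in> set xs \<Longrightarrow> f x = f y \<Longrightarrow> x = y) \<Longrightarrow> map f xs = map f ys \<Longrightarrow> xs = ys"
proof (induction xs arbitrary: ys)
  case (Cons x xs)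
  then show ?case by (cases ys) auto
qed simp

locale coding =
  fixes J :: "nat \<Rightarrow> 'u \<Rightarrow> 'u \<Rightarrow> 'u"
  assumes J_inj [simp]: "J i x y = J j x' y' \<longleftrightarrow> i = j \<and> x = x' \<and> y = y'"
begin

definition ncode :: "nat \<Rightarrow> 'u" where
  "ncode n = J n undefined undefined"

primrec lcode :: "'u list \<Rightarrow> 'u" where
  "lcode [] = J 0 undefined undefined"
| "lcode (x # xs) = J 1 x (lcode xs)"

primrec tcode :: "('u, 'u) trm \<Rightarrow> 'u" where
  "tcode (Var n) = J 0 (ncode n) undefined"
| "tcode (Cst c) = J 1 c undefined"
| "tcode (Fun f ts) = J 2 f (lcode (map tcode ts))"

primrec fcode :: "('u, 'u, 'u) fm \<Rightarrow> 'u" where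
  "fcode (Pred P ts) = J 0 P (lcode (map tcode ts))"
| "fcode (Unary h \<phi>) = J (case h of UNeg \<Rightarrow> 1 | UCirc \<Rightarrow> 2) (fcode \<phi>) undefined"
| "fcode (Binary h \<phi> \<psi>) = J (case h of BAnd \<Rightarrow> 3 | BOr \<Rightarrow> 4 | BImp \<Rightarrow> 5) (fcode \<phi>) (fcode \<psi>)"
| "fcode (Quant Q x \<phi>) = J (case Q of QAll \<Rightarrow> 6 | QEx \<Rightarrow> 7) (ncode x) (fcode \<phi>)"

primrec hcode :: "('u, 'u, 'u) hc \<Rightarrow> 'u" where
  "hcode (Base c) = J 0 c undefined"
| "hcode (Hen Q x \<psi>) = J (case Q of QAll \<Rightarrow> 1 | QEx \<Rightarrow> 2) (ncode x) (fcode (map_fm hcode id id \<psi>))"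

lemma ncode_inj [simp]: "ncode m = ncode n \<longleftrightarrow> m = n"
  by (simp add: ncode_def)

lemma lcode_inj [simp]: "lcode xs = lcode ys \<longleftrightarrow> xs = ys"
  by (induction xs arbitrary: ys) (case_tac ys; simp)+

lemma tcode_inj: "tcode s = tcode t \<Longrightarrow> s = t"
proof (induction s arbitrary: t)
  case (Fun f ts)
  then obtain ss where "t = Fun f ss" "map tcode ts = map tcode ss" by (cases t) auto
  with map_inj_on_left[of ts tcode ss] Fun.IH show ?case by blast
qed (case_tac t; simp)+

lemma fcode_inj: "fcode \<phi> = fcode \<psi> \<Longrightarrow> \<phi> = \<psi>"
proof (induction \<phi> arbitrary: \<psi>)
  case (Pred P ts)
  then obtain ss where "\<psi> = Pred P ss" "map tcode ts = map tcode ss"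
    by (cases \<psi>) (auto split: unop.splits binop.splits quant.splits)
  with map_inj_on_left[of ts tcode ss] tcode_inj show ?case by blast
next
  case (Unary h \<phi>)
  then show ?case by (cases \<psi>) (auto split: unop.splits binop.splits quant.splits)
next
  case (Binary h \<phi> \<phi>')
  then show ?case by (cases \<psi>) (auto split: unop.splits binop.splits quant.splits)
next
  case (Quant Q x \<phi>)
  then show ?case by (cases \<psi>) (auto split: unop.splits binop.splits quant.splits)
qed

lemma hcode_inj: "hcode c = hcode d \<Longrightarrow> c = d"
proof (induction c arbitrary: d)
  case (Base c)
  then show ?case by (cases d) (auto split: quant.splits)
next
  case (Hen Q x \<psi>)
  then obtain Q' x' \<psi>' where d: "d = Hen Q' x' \<psi>'" by (cases d) (auto split: quant.splits)
  with Hen.prems have eq: "Q' = Q" "x' = x" "map_fm hcode id id \<psi> = map_fm hcode id id \<psi>'"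
    by (auto split: quant.splits dest: fcode_inj)
  have "\<psi> = \<psi>'"
    by (rule fm.inj_map_strong[OF _ _ _ eq(3)]) (use Hen.IH in auto)
  then show ?case by (simp add: d eq)
qed

end

lemma ex_coding:
  assumes "infinite (UNIV :: 'u set)"
  shows "\<exists>J :: nat \<Rightarrow> 'u \<Rightarrow> 'u \<Rightarrow> 'u. coding J"
proof -
  obtain f :: "'u \<times> 'u \<Rightarrow> 'u" where f: "inj f"
    using card_of_Times_same_infinite[OF assms] unfolding card_of_ordIso[symmetric]
    by (auto simp: bij_betw_def)
  obtain g :: "nat \<Rightarrow> 'u" where g: "inj g"
    using infinite_countable_subset[OF assms] by blast
  have "coding (\<lambda>i x y. f (g i, f (x, y)))"
    by unfold_locales (use injD[OF f] injD[OF g] in blast)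
  then show ?thesis by blast
qed

text \<open>Every symbol of \<Theta> is represented by a formula containing it, which
  \<open>e\<close> sends into \<open>'u\<close>. After this relabelling a term of the extended
  language is a tree over \<open>'u\<close> and can be coded there.\<close>

lemma ex_inj_Ter_hen_sig:
  fixes \<Theta> :: "('c, 'f, 'p) sig"
  assumes "signature \<Theta>" and "For \<Theta> \<lesssim> (UNIV :: 'u set)"
  shows "\<exists>h :: (('c, 'f, 'p) hc, 'f) trm \<Rightarrow> 'u. inj_on h (Ter (hen_sig \<Theta>))"
proof -
  obtain e :: "('c, 'f, 'p) fm \<Rightarrow> 'u" where e: "inj_on e (For \<Theta>)"
    using assms(2) by (auto simp: lepoll_def)
  obtain n P where n: "n \<ge> 1" "P \<in> pr \<Theta> n" using assms(1) by (auto simp: signature_def)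
  have n0: "n \<noteq> 0" using n by simp
  have atom: "Pred P (replicate n t) \<in> For \<Theta>" if "t \<in> Ter \<Theta>" for t
    using that n by auto
  \<comment> \<open>Infinitely many variables and one predicate symbol yield infinitely many
    formulas, which forces \<open>'u\<close> to be infinite.\<close>
  have "inj (\<lambda>i. e (Forall i (Pred P (replicate n (Var 0)))))"
    using atom[of "Var 0"] by (auto intro!: injI dest!: inj_onD[OF e])
  then have "infinite (UNIV :: 'u set)" 
    using infinite_iff_countable_subset[of "UNIV :: 'u set"] by auto
  then obtain J :: "nat \<Rightarrow> 'u \<Rightarrow> 'u \<Rightarrow> 'u" where "coding J" using ex_coding by blast
  then interpret coding J .
  \<comment> \<open>A name may be a symbol at several arities; one is selected so that the
    representing formula depends on the name alone.\<close>
  define arity where "arity f = (SOME k. k \<ge> 1 \<and> f \<in> fn \<Theta> k)" for f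
  define arityp where "arityp p = (SOME k. k \<ge> 1 \<and> p \<in> pr \<Theta> k)" for p
  have arity: "arity f \<ge> 1 \<and> f \<in> fn \<Theta> (arity f)" if "f \<in> fn_names \<Theta>" for f
    unfolding arity_def
    by (rule someI_ex[where P = "\<lambda>k. k \<ge> 1 \<and> f \<in> fn \<Theta> k"]) (use that in \<open>auto simp: fn_names_def\<close>)
  have arityp: "arityp p \<ge> 1 \<and> p \<in> pr \<Theta> (arityp p)" if "p \<in> pr_names \<Theta>" for p
    unfolding arityp_def
    by (rule someI_ex[where P = "\<lambda>k. k \<ge> 1 \<and> p \<in> pr \<Theta> k"]) (use that in \<open>auto simp: pr_names_def\<close>)
  \<comment> \<open>A constant or function name is exhibited inside an atom; since \<open>n\<close>
    is at least 1, it really occurs there and can be recovered.\<close>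
  define g1 where "g1 c = e (Pred P (replicate n (Cst c)))" for c
  define g2 where "g2 f = e (Pred P (replicate n (Fun f (replicate (arity f) (Var 0)))))" for f
  define g3 where "g3 p = e (Pred p (replicate (arityp p) (Var 0)))" for p
  have g1: "c = d" if "c \<in> cn \<Theta>" "d \<in> cn \<Theta>" "g1 c = g1 d" for c d
    using inj_onD[OF e that(3)[unfolded g1_def]] that(1,2) atom[of "Cst c"] atom[of "Cst d"] n0 by simp
  have g2: "f = g" if "f \<in> fn_names \<Theta>" "g \<in> fn_names \<Theta>" "g2 f = g2 g" for f g
  proof -
    have "Fun f (replicate (arity f) (Var 0)) \<in> Ter \<Theta>" "Fun g (replicate (arity g) (Var 0)) \<in> Ter \<Theta>"
      using arity[OF that(1)] arity[OF that(2)] by auto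
    from inj_onD[OF e that(3)[unfolded g2_def] atom[OF this(1)] atom[OF this(2)]] n0
    show ?thesis by simp
  qed
  have g3: "p = q" if "p \<in> pr_names \<Theta>" "q \<in> pr_names \<Theta>" "g3 p = g3 q" for p q
    using inj_onD[OF e that(3)[unfolded g3_def]] arityp[OF that(1)] arityp[OF that(2)] by auto
  define k where "k c = hcode (map_hc g1 g2 g3 c)" for c
  have k: "c = d" if "c \<in> cn (hen_sig \<Theta>)" "d \<in> cn (hen_sig \<Theta>)" "k c = k d" for c d
  proof (rule hc.inj_map_strong)
    have names: "set1_hc c \<subseteq> cn \<Theta>" "set1_hc d \<subseteq> cn \<Theta>" "set2_hc c \<subseteq> fn_names \<Theta>"
      "set2_hc d \<subseteq> fn_names \<Theta>" "set3_hc c \<subseteq> pr_names \<Theta>" "set3_hc d \<subseteq> pr_names \<Theta>"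
      using that(1,2) by (auto simp: hen_sig_def)
    show "x = y" if "x \<in> set1_hc c" "y \<in> set1_hc d" "g1 x = g1 y" for x y
      using that names g1 by blast
    show "x = y" if "x \<in> set2_hc c" "y \<in> set2_hc d" "g2 x = g2 y" for x y
      using that names g2 by blast
    show "x = y" if "x \<in> set3_hc c" "y \<in> set3_hc d" "g3 x = g3 y" for x y
      using that names g3 by blast
    show "map_hc g1 g2 g3 c = map_hc g1 g2 g3 d" using that(3) by (simp add: k_def hcode_inj)
  qed
  have "inj_on (\<lambda>t. tcode (map_trm k g2 t)) (Ter (hen_sig \<Theta>))"
  proof (rule inj_onI)
    fix s t
    assume st: "s \<in> Ter (hen_sig \<Theta>)" "t \<in> Ter (hen_sig \<Theta>)"
      and "tcode (map_trm k g2 s) = tcode (map_trm k g2 t)"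
    then have "map_trm k g2 s = map_trm k g2 t" by (simp add: tcode_inj)
    moreover have "fn_names (hen_sig \<Theta>) = fn_names \<Theta>" by (simp add: fn_names_def)
    then have "set1_trm s \<subseteq> cn (hen_sig \<Theta>)" "set1_trm t \<subseteq> cn (hen_sig \<Theta>)"
      "set2_trm s \<subseteq> fn_names \<Theta>" "set2_trm t \<subseteq> fn_names \<Theta>"
      using names_trm[OF st(1)] names_trm[OF st(2)] by auto
    ultimately show "s = t" using k g2 by (intro trm.inj_map_strong[of s t k k g2 g2]) blast+
  qed
  then show ?thesis by blast
qed

section \<open>Completeness\<close>

lemma sentence_completeness:
  fixes \<Theta> :: "('c, 'f, 'p) sig"
  assumes "signature \<Theta>" "For \<Theta> \<lesssim> (UNIV :: 'u set)" and "\<Gamma> \<subseteq> For \<Theta>" "\<phi> \<in> Sen \<Theta>"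
    and "\<not> (\<Theta>, \<Gamma> \<turnstile>QmbC \<phi>)"
  shows "\<exists>\<AA> :: ('c, 'f, 'p, 'u) str. structure \<Theta> \<AA> \<and> \<not> consequence \<Theta> \<AA> \<Gamma> \<phi>"
proof -
  have \<phi>: "base \<phi> \<in> Sen (hen_sig \<Theta>)"
    using assms(4) by (auto simp: Sen_def base_For FV_fcs_closed)
  then have "\<not> (hen_sig \<Theta>, base ` \<Gamma> \<union> hen_axioms \<Theta> \<turnstile>QmbC base \<phi>)"
    using assms(5) hen_axioms_conservative base_conservative by blast
  then obtain K where K: "base ` \<Gamma> \<union> hen_axioms \<Theta> \<subseteq> K" "\<not> (hen_sig \<Theta>, K \<turnstile>QmbC base \<phi>)"
    "\<And>\<alpha>. \<alpha> \<in> Sen (hen_sig \<Theta>) \<Longrightarrow> hen_sig \<Theta>, K \<turnstile>QmbC \<alpha> \<or> hen_sig \<Theta>, K \<turnstile>QmbC \<alpha> \<^bold>\<longrightarrow> base \<phi>"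
    using lindenbaum by blast
  obtain h :: "(('c, 'f, 'p) hc, 'f) trm \<Rightarrow> 'u" where h: "inj_on h (Ter (hen_sig \<Theta>))"
    using ex_inj_Ter_hen_sig[OF assms(1,2)] by blast
  interpret henkin_set \<Theta> K "base \<phi>" h
    by unfold_locales (use \<phi> K h in auto)
  have "\<not> consequence \<Theta> canon \<Gamma> \<phi>"
    using K(1) assms(3) by (intro not_consequence) (auto intro!: Prem base_For)
  then show ?thesis using structure_canon by blast
qed

text \<open>The conclusion is designated under every assignment, so an added universal quantifier
  only asks for values already known to be designated.\<close>

lemma consequence_foldr_Forall:
  assumes "structure \<Theta> \<AA>" "\<phi> \<in> For \<Theta>" "consequence \<Theta> \<AA> \<Gamma> \<phi>"
  shows "consequence \<Theta> \<AA> \<Gamma> (foldr Forall xs \<phi>)"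
  unfolding consequence_def
proof (intro allI impI)
  fix v \<mu>
  assume v: "valuation \<Theta> \<AA> v" and \<mu>: "assignment \<AA> \<mu>"
    and "\<forall>\<gamma>\<in>\<Gamma>. \<forall>\<mu>. assignment \<AA> \<mu> \<longrightarrow> v (inst \<mu> (embed \<gamma>)) \<in> D5"
  then have base: "v (inst \<mu> (embed \<phi>)) \<in> D5" if "assignment \<AA> \<mu>" for \<mu>
    using assms(3) that unfolding consequence_def by blast
  interpret qmbc_val \<Theta> \<AA> v using assms(1) v by unfold_locales
  have F: "embed (foldr Forall xs \<phi>) \<in> F" for xs
    using assms(2) by (intro embed_F) (simp add: foldr_Forall_For)
  have "holds \<mu> (embed (foldr Forall xs \<phi>))"
    using \<mu>
  proof (induction xs arbitrary: \<mu>)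
    case Nil
    then show ?case using base by (simp add: D5_def)
  next
    case (Cons x xs)
    then show ?case using F[of xs] by (simp add: assignment_def)
  qed
  then show "v (inst \<mu> (embed (foldr Forall xs \<phi>))) \<in> D5"
    using F \<mu> by (simp add: D5_def v_M5 inst_S)
qed

text \<open>All structures are represented by those over one type \<open>'u\<close> with room for
  the canonical domain; the second conjunct extends soundness to domains in any type
  \<open>'w\<close>, whatever its size.\<close>

theorem theorem9p6:
  fixes \<Theta> :: "('c, 'f, 'p) sig"
    and \<Gamma> :: "('c, 'f, 'p) fm set"
    and \<phi> :: "('c, 'f, 'p) fm"
  assumes "signature \<Theta>"
    and "\<Gamma> \<union> {\<phi>} \<subseteq> For \<Theta>"
    and "For \<Theta> \<lesssim> (UNIV :: 'u set)"
  shows "(\<Theta>, \<Gamma> \<turnstile>QmbC \<phi> \<longleftrightarrow>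
            (\<forall>\<AA> :: ('c, 'f, 'p, 'u) str. structure \<Theta> \<AA> \<longrightarrow> consequence \<Theta> \<AA> \<Gamma> \<phi>))
       \<and> (\<Theta>, \<Gamma> \<turnstile>QmbC \<phi> \<longrightarrow>
            (\<forall>\<BB> :: ('c, 'f, 'p, 'w) str. structure \<Theta> \<BB> \<longrightarrow> consequence \<Theta> \<BB> \<Gamma> \<phi>))"
proof (intro conjI iffI allI impI)
  assume c: "\<forall>\<AA> :: ('c, 'f, 'p, 'u) str. structure \<Theta> \<AA> \<longrightarrow> consequence \<Theta> \<AA> \<Gamma> \<phi>"
  \<comment> \<open>Completeness is available for sentences, so \<phi> is replaced by its universal
    closure and recovered from it by instantiation.\<close>
  obtain xs where xs: "set xs = FV \<phi>" using finite_list[OF finite_FV] by blast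
  have \<phi>: "\<phi> \<in> For \<Theta>" using assms(2) by simp
  have "\<Theta>, \<Gamma> \<turnstile>QmbC foldr Forall xs \<phi>"
  proof (rule ccontr)
    assume "\<not> (\<Theta>, \<Gamma> \<turnstile>QmbC foldr Forall xs \<phi>)"
    moreover have "foldr Forall xs \<phi> \<in> Sen \<Theta>"
      using \<phi> xs by (simp add: Sen_def foldr_Forall_For FV_foldr_Forall)
    ultimately obtain \<AA> :: "('c, 'f, 'p, 'u) str" where
      "structure \<Theta> \<AA>" "\<not> consequence \<Theta> \<AA> \<Gamma> (foldr Forall xs \<phi>)"
      using sentence_completeness[OF assms(1,3)] assms(2) by blast
    with consequence_foldr_Forall[OF this(1) \<phi>] c show False by metis
  qed
  then show "\<Theta>, \<Gamma> \<turnstile>QmbC \<phi>" by (rule derives_foldr_ForallD)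
qed (simp_all add: soundness)

end
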